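(* Suppose $B\in\mathcal{Y}$. Let $f,g\in L^2(\mathbb{P}_\eta)$ be increasing on $B$ and decreasing on $\mathbb{Y}\setminus B$. Then $$\mathbb{E}[f(\eta)g(\eta)]\ge(\mathbb{E}f(\eta))(\mathbb{E}g(\eta)).$$
   Context: Let $(\mathbb{Y},\mathcal{Y})$ be an arbitrary measurable space and $\lambda$ an arbitrary $\sigma$-finite measure on it. Let $\mathbf{N}=\mathbf{N}(\mathbb{Y})$ be the space of all $\sigma$-finite measures $\mu$ on $\mathbb{Y}$ with values in $\{0,1,2,\ldots\}\cup\{\infty\}$, equipped with the smallest $\sigma$-field making $\mu\mapsto\mu(B)$ measurable for every $B\in\mathcal{Y}$. On a probability space $(\Omega,\mathcal{F},\mathbb{P})$, $\eta$ is a Poisson process on $\mathbb{Y}$ with intensity measure $\lambda$: a random element of $\mathbf{N}$ such that $\eta(B)$ is Poisson distributed with parameter $\lambda(B)$ for each $B\in\mathcal{Y}$, and $\eta(B_1),\ldots,\eta(B_k)$ are independent for pairwise disjoint $B_1,\ldots,B_k\in\mathcal{Y}$. $\mathbb{P}_\eta$ is the distribution of $\eta$, and $L^2(\mathbb{P}_\eta)$ is the space of measurable $f:\mathbf{N}\to\mathbb{R}$ with $\mathbb{E}f(\eta)^2<\infty$. For $B\in\mathcal{Y}$, a function $f:\mathbf{N}\to\mathbb{R}$ is increasing on $B$ if $f(\mu+\delta_y)\ge f(\mu)$ for all $\mu\in\mathbf{N}$ and all $y\in B$, where $\delta_y$ is the Dirac measure at $y$; it is decreasing on $B$ if $-f$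 is increasing on $B$. *)

theory Defs
  imports "HOL-Probability.Probability"
begin

text \<open>As usual in HOL-Probability, a measurable space is represented by a measure \<open>Y\<close> of which
  only \<open>space Y\<close> and \<open>sets Y\<close> are used.\<close>

definition counting_measures :: "'a measure \<Rightarrow> 'a measure set" where
  "counting_measures Y = {\<mu>. sets \<mu> = sets Y \<and> sigma_finite_measure \<mu> \<and>
     (\<forall>B\<in>sets Y. emeasure \<mu> B \<in> range of_nat \<union> {\<infinity>})}"

definition counting_measure_space :: "'a measure \<Rightarrow> 'a measure measure" where
  "counting_measure_space Y = sigma (counting_measures Y)
     {(\<lambda>\<mu>. emeasure \<mu> B) -` A \<inter> counting_measures Y | A B. A \<in> sets borel \<and> B \<in> sets Y}"

definition add_measure :: "'a measure \<Rightarrow> 'a measure \<Rightarrow> 'a measure" where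
  "add_measure \<mu> \<nu> = measure_of (space \<mu>) (sets \<mu>) (\<lambda>A. emeasure \<mu> A + emeasure \<nu> A)"

text \<open>The Dirac measure at \<open>y\<close> is \<open>return Y y\<close>.\<close>

definition increasing_on :: "'a measure \<Rightarrow> 'a set \<Rightarrow> ('a measure \<Rightarrow> real) \<Rightarrow> bool" where
  "increasing_on Y B f \<longleftrightarrow>
     (\<forall>\<mu>\<in>space (counting_measure_space Y). \<forall>y\<in>B. f (add_measure \<mu> (return Y y)) \<ge> f \<mu>)"

definition decreasing_on :: "'a measure \<Rightarrow> 'a set \<Rightarrow> ('a measure \<Rightarrow> real) \<Rightarrow> bool" where
  "decreasing_on Y B f \<longleftrightarrow> increasing_on Y B (\<lambda>\<mu>. - f \<mu>)"

text \<open>The parameter ranges over \<open>[0, \<infinity>]\<close>: parameter \<open>0\<close> gives the point mass at \<open>0\<close>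
  (since \<open>0 ^ 0 = 1\<close>), and parameter \<open>\<infinity>\<close> gives the point mass at \<open>\<infinity>\<close>. The library's
  \<open>poisson_pmf\<close> covers only parameters in \<open>(0, \<infinity>)\<close>.\<close>

definition poisson_distributed :: "'w measure \<Rightarrow> ('w \<Rightarrow> ennreal) \<Rightarrow> ennreal \<Rightarrow> bool" where
  "poisson_distributed M X r \<longleftrightarrow> X \<in> borel_measurable M \<and>
     (if r = \<infinity> then measure M {\<omega>\<in>space M. X \<omega> = \<infinity>} = 1
      else \<forall>k::nat. measure M {\<omega>\<in>space M. X \<omega> = of_nat k}
             = enn2real r ^ k / fact k * exp (- enn2real r))"

definition poisson_process ::
    "'w measure \<Rightarrow> 'a measure \<Rightarrow> 'a measure \<Rightarrow> ('w \<Rightarrow> 'a measure) \<Rightarrow> bool" where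
  "poisson_process M Y lam \<eta> \<longleftrightarrow>
     \<eta> \<in> measurable M (counting_measure_space Y) \<and>
     (\<forall>B\<in>sets Y. poisson_distributed M (\<lambda>\<omega>. emeasure (\<eta> \<omega>) B) (emeasure lam B)) \<and>
     (\<forall>(k::nat) B. B ` {..<k} \<subseteq> sets Y \<longrightarrow> disjoint_family_on B {..<k} \<longrightarrow>
        prob_space.indep_vars M (\<lambda>_. borel) (\<lambda>i \<omega>. emeasure (\<eta> \<omega>) (B i)) {..<k})"

definition L2_space :: "'b measure \<Rightarrow> ('b \<Rightarrow> real) set" where
  "L2_space P = {f \<in> borel_measurable P. integrable P (\<lambda>x. (f x)\<^sup>2)}"

lemma space_counting_measure_space [simp]:
  "space (counting_measure_space Y) = counting_measures Y"
  by (simp add: counting_measure_space_def space_measure_of_conv)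

lemma sets_add_measure [simp]: "sets (add_measure \<mu> \<nu>) = sets \<mu>"
  by (simp add: add_measure_def)

lemma space_add_measure [simp]: "space (add_measure \<mu> \<nu>) = space \<mu>"
  by (simp add: add_measure_def)

lemma emeasure_add_measure:
  assumes "sets \<nu> = sets \<mu>" "A \<in> sets \<mu>"
  shows "emeasure (add_measure \<mu> \<nu>) A = emeasure \<mu> A + emeasure \<nu> A"
proof (rule emeasure_measure_of[OF add_measure_def])
  show "countably_additive (sets (add_measure \<mu> \<nu>)) (\<lambda>A. emeasure \<mu> A + emeasure \<nu> A)"
    unfolding countably_additive_def
  proof (intro allI impI)
    fix F :: "nat \<Rightarrow> 'a set"
    assume F: "range F \<subseteq> sets (add_measure \<mu> \<nu>)" "disjoint_family F"
    have "(\<Sum>i. emeasure \<mu> (F i) + emeasure \<nu> (F i)) =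
        (\<Sum>i. emeasure \<mu> (F i)) + (\<Sum>i. emeasure \<nu> (F i))"
      by (intro suminf_add[symmetric]) auto
    also have "(\<Sum>i. emeasure \<mu> (F i)) = emeasure \<mu> (\<Union>(range F))"
      using F by (intro suminf_emeasure) auto
    also have "(\<Sum>i. emeasure \<nu> (F i)) = emeasure \<nu> (\<Union>(range F))"
      using F assms(1) by (intro suminf_emeasure) auto
    finally show "(\<Sum>i. emeasure \<mu> (F i) + emeasure \<nu> (F i)) =
        emeasure \<mu> (\<Union>(range F)) + emeasure \<nu> (\<Union>(range F))" .
  qed
qed (use assms sets.space_closed in \<open>auto simp: positive_def\<close>)

lemma add_dirac_in_counting_measures:
  assumes "\<mu> \<in> counting_measures Y" "y \<in> space Y"
  shows "add_measure \<mu> (return Y y) \<in> counting_measures Y"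
proof -
  have sets: "sets \<mu> = sets Y" and sf: "sigma_finite_measure \<mu>"
    and cnt: "\<And>B. B \<in> sets Y \<Longrightarrow> emeasure \<mu> B \<in> range of_nat \<union> {\<infinity>}"
    using assms(1) by (auto simp: counting_measures_def)
  have em: "emeasure (add_measure \<mu> (return Y y)) B = emeasure \<mu> B + indicator B y"
    if "B \<in> sets Y" for B
    using that sets by (simp add: emeasure_add_measure)
  have "sigma_finite_measure (add_measure \<mu> (return Y y))"
  proof
    obtain A where "countable A" "A \<subseteq> sets \<mu>" "\<Union>A = space \<mu>" "\<forall>a\<in>A. emeasure \<mu> a \<noteq> \<infinity>"
      using sigma_finite_measure.sigma_finite_countable[OF sf] by blast
    then show "\<exists>A. countable A \<and> A \<subseteq> sets (add_measure \<mu> (return Y y)) \<and>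
        \<Union>A = space (add_measure \<mu> (return Y y)) \<and>
        (\<forall>a\<in>A. emeasure (add_measure \<mu> (return Y y)) a \<noteq> \<infinity>)"
      using sets em by (intro exI[of _ A]) (auto simp: indicator_def subset_iff)
  qed
  moreover have "emeasure (add_measure \<mu> (return Y y)) B \<in> range of_nat \<union> {\<infinity>}"
    if B: "B \<in> sets Y" for B
  proof (cases "emeasure \<mu> B = \<infinity>")
    case True
    then show ?thesis using em[OF B] by simp
  next
    case False
    then obtain n :: nat where "emeasure \<mu> B = of_nat n" using cnt[OF B] by auto
    then have "emeasure (add_measure \<mu> (return Y y)) B = of_nat (n + indicator B y)"
      using em[OF B] by (simp add: indicator_def)
    then show ?thesis by blast
  qed
  ultimately show ?thesis
    using sets by (simp add: counting_measures_def)
qed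

end

theory Submission
  imports Defs
begin

text \<open>
  Fix a set \<open>Z\<close> of finite intensity. By uniqueness, the law of \<open>\<eta>\<close> is that of \<open>\<eta>\<close> restricted to the complement of
  \<open>Z\<close> plus an independent finite sum of Dirac measures at random points of \<open>Z\<close>, even though the realisations of
  \<open>\<eta>\<close> itself need not be sums of Dirac measures on an arbitrary measurable space. Adding such a Poisson sum is
  the limit of \<open>m\<close> successive steps, each of which adds at most one point, with probability of order \<open>1 / m\<close>. The
  increments of \<open>f\<close> and \<open>g\<close> under a single point have equal signs, so each step has covariance at least
  \<open>- const / m\<^sup>2\<close>; in the limit \<open>f\<close> and \<open>g\<close> are positively correlated conditionally on \<open>\<eta>\<close> outside \<open>Z\<close>. As \<open>Z\<close>
  exhausts the space, \<open>f\<close> is approximated in \<open>L\<^sup>1\<close> by functions of \<open>\<eta>\<close> inside \<open>Z\<close>, so its conditional expectation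
  given \<open>\<eta>\<close> outside \<open>Z\<close> tends to its mean. This gives the claim for bounded functions; the rest is truncation.
\<close>

section \<open>Counting measures\<close>

text \<open>On an abstract space the points of \<open>\<eta>\<close> can be neither listed nor
  thinned, so the splitting at \<open>Z\<close> is an identity of laws, proved by counting: the
  multinomial distribution of \<open>n\<close> inserted points, mixed over a Poisson
  \<open>n\<close>, gives independent Poisson counts. Inserting a whole Poisson process offers no
  sign to exploit, since points in \<open>B\<close> and off \<open>B\<close> push \<open>f\<close>
  in opposite directions; hence the division into single points. The induction over these steps
  closes because each is an average that keeps bounds, inequalities and constants, and keeps
  monotonicity because adding points commutes; the errors merely add up. Conditioning yields E[fg] =
  E[L(fg)] \<ge> E[Lf Lg], with L the conditional mean, and this spares a proof that the outside
  process is associated: as \<open>g\<close> is bounded, it is enough that Lf is L1-close to the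
  constant E f, so locality is exploited for \<open>f\<close> alone. The closeness comes from local
  functionals: their conditional mean sees the outside process only where it has no points, and is
  almost surely constant.\<close>

lemma measurable_emeasure_counting [measurable]:
  assumes "B \<in> sets Y"
  shows "(\<lambda>\<mu>. emeasure \<mu> B) \<in> borel_measurable (counting_measure_space Y)"
proof (rule measurableI)
  fix A :: "ennreal set" assume "A \<in> sets borel"
  then show "(\<lambda>\<mu>. emeasure \<mu> B) -` A \<inter> space (counting_measure_space Y) \<in> sets (counting_measure_space Y)"
    unfolding space_counting_measure_space unfolding counting_measure_space_def
    using assms by (subst sets_measure_of) (auto intro!: sigma_sets.Basic)
qed simp

lemma measurable_counting_measure_spaceI:
  assumes "\<And>w. w \<in> space M \<Longrightarrow> F w \<in> counting_measures Y"
    and "\<And>B. B \<in> sets Y \<Longrightarrow> (\<lambda>w. emeasure (F w) B) \<in> borel_measurable M"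
  shows "F \<in> measurable M (counting_measure_space Y)"
  unfolding counting_measure_space_def
proof (rule measurable_measure_of)
  fix S assume "S \<in> {(\<lambda>\<mu>. emeasure \<mu> B) -` A \<inter> counting_measures Y |A B. A \<in> sets borel \<and> B \<in> sets Y}"
  then obtain A B where S: "S = (\<lambda>\<mu>. emeasure \<mu> B) -` A \<inter> counting_measures Y"
    and AB: "A \<in> sets borel" "B \<in> sets Y" by blast
  have "F -` S \<inter> space M = (\<lambda>w. emeasure (F w) B) -` A \<inter> space M"
    using assms(1) S by auto
  also have "\<dots> \<in> sets M"
    using assms(2)[OF AB(2)] AB(1) by (rule measurable_sets)
  finally show "F -` S \<inter> space M \<in> sets M" .
qed (use assms(1) in auto)

lemma counting_measures_sets: "\<mu> \<in> counting_measures Y \<Longrightarrow> sets \<mu> = sets Y"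
  by (simp add: counting_measures_def)

lemma counting_measures_values:
  "\<mu> \<in> counting_measures Y \<Longrightarrow> A \<in> sets Y \<Longrightarrow> emeasure \<mu> A \<in> range of_nat \<union> {\<infinity>}"
  by (simp add: counting_measures_def)

lemma emeasure_add_point:
  assumes "\<mu> \<in> counting_measures Y" "A \<in> sets Y"
  shows "emeasure (add_measure \<mu> (return Y y)) A = emeasure \<mu> A + indicator A y"
  using assms counting_measures_sets[OF assms(1)] by (simp add: emeasure_add_measure)

lemma add_point_commute:
  assumes "\<mu> \<in> counting_measures Y" "x \<in> space Y" "y \<in> space Y"
  shows "add_measure (add_measure \<mu> (return Y x)) (return Y y) =
         add_measure (add_measure \<mu> (return Y y)) (return Y x)"
proof (rule measure_eqI)
  fix A assume "A \<in> sets (add_measure (add_measure \<mu> (return Y x)) (return Y y))"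
  then have "A \<in> sets Y" using counting_measures_sets[OF assms(1)] by simp
  then show "emeasure (add_measure (add_measure \<mu> (return Y x)) (return Y y)) A =
      emeasure (add_measure (add_measure \<mu> (return Y y)) (return Y x)) A"
    using assms by (simp add: emeasure_add_point add_dirac_in_counting_measures ac_simps)
qed simp

text \<open>Joint measurability in the measure and the point is what Fubini requires once the added
  point is random.\<close>

lemma measurable_add_point [measurable]:
  "(\<lambda>(\<mu>, x). add_measure \<mu> (return Y x)) \<in>
     measurable (counting_measure_space Y \<Otimes>\<^sub>M Y) (counting_measure_space Y)"
proof (rule measurable_counting_measure_spaceI)
  fix B assume [measurable]: "B \<in> sets Y"
  have "(\<lambda>w. emeasure (fst w) B + indicator B (snd w)) \<in> borel_measurable (counting_measure_space Y \<Otimes>\<^sub>M Y)"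
    by measurable
  then show "(\<lambda>w. emeasure (case w of (\<mu>, x) \<Rightarrow> add_measure \<mu> (return Y x)) B)
      \<in> borel_measurable (counting_measure_space Y \<Otimes>\<^sub>M Y)"
    by (rule measurable_cong[THEN iffD1, rotated]) (auto simp: space_pair_measure emeasure_add_point)
qed (auto simp: space_pair_measure add_dirac_in_counting_measures)

lemma restrict_in_counting_measures:
  assumes "\<mu> \<in> counting_measures Y" "C \<in> sets Y"
  shows "density \<mu> (indicator C) \<in> counting_measures Y"
proof -
  have sets: "sets \<mu> = sets Y" and sf: "sigma_finite_measure \<mu>"
    using assms(1) by (auto simp: counting_measures_def)
  have em: "emeasure (density \<mu> (indicator C)) A = emeasure \<mu> (C \<inter> A)" if "A \<in> sets Y" for A
    using that assms sets by (simp add: emeasure_restricted)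
  have "sigma_finite_measure (density \<mu> (indicator C))"
  proof
    obtain A where A: "countable A" "A \<subseteq> sets \<mu>" "\<Union>A = space \<mu>" "\<forall>a\<in>A. emeasure \<mu> a \<noteq> \<infinity>"
      using sigma_finite_measure.sigma_finite_countable[OF sf] by blast
    have "emeasure (density \<mu> (indicator C)) a \<noteq> \<infinity>" if "a \<in> A" for a
    proof -
      have "emeasure \<mu> (C \<inter> a) \<le> emeasure \<mu> a"
        using that A(2) by (intro emeasure_mono) auto
      then show ?thesis
        using that A(2,4) em[of a] sets by (auto simp: top_unique)
    qed
    with A show "\<exists>A. countable A \<and> A \<subseteq> sets (density \<mu> (indicator C)) \<and>
        \<Union>A = space (density \<mu> (indicator C)) \<and> (\<forall>a\<in>A. emeasure (density \<mu> (indicator C)) a \<noteq> \<infinity>)"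
      by (intro exI[of _ A]) auto
  qed
  moreover have "emeasure (density \<mu> (indicator C)) A \<in> range of_nat \<union> {\<infinity>}" if "A \<in> sets Y" for A
    using counting_measures_values[OF assms(1), of "C \<inter> A"] that assms(2) em[OF that] by auto
  ultimately show ?thesis using sets by (simp add: counting_measures_def)
qed

lemma emeasure_restrict_counting:
  assumes "\<mu> \<in> counting_measures Y" "C \<in> sets Y" "A \<in> sets Y"
  shows "emeasure (density \<mu> (indicator C)) A = emeasure \<mu> (C \<inter> A)"
  using assms counting_measures_sets[OF assms(1)] by (simp add: emeasure_restricted)

lemma measurable_restrict_counting [measurable]:
  assumes [measurable]: "C \<in> sets Y"
  shows "(\<lambda>\<mu>. density \<mu> (indicator C)) \<in>
     measurable (counting_measure_space Y) (counting_measure_space Y)"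
proof (rule measurable_counting_measure_spaceI)
  fix B assume [measurable]: "B \<in> sets Y"
  have "(\<lambda>w. emeasure w (C \<inter> B)) \<in> borel_measurable (counting_measure_space Y)" by measurable
  then show "(\<lambda>w. emeasure (density w (indicator C)) B) \<in> borel_measurable (counting_measure_space Y)"
    by (rule measurable_cong[THEN iffD1, rotated]) (auto simp: emeasure_restrict_counting)
qed (auto simp: restrict_in_counting_measures)

section \<open>Uniqueness of laws of counting measures\<close>

text \<open>Compatibility with \<open>Z\<close> later separates the cells that can receive inserted
  points from those that insertion leaves untouched.\<close>

definition fine_partition :: "'a measure \<Rightarrow> 'a set \<Rightarrow> 'a set set \<Rightarrow> bool" where
  "fine_partition Y Z R \<longleftrightarrow> finite R \<and> R \<subseteq> sets Y \<and> disjoint R \<and> \<Union>R = space Y \<and>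
     (\<forall>A\<in>R. A \<subseteq> Z \<or> A \<inter> Z = {})"

definition cell :: "'a measure \<Rightarrow> 'a set set \<Rightarrow> ('a set \<Rightarrow> ennreal) \<Rightarrow> 'a measure set" where
  "cell Y R c = {\<nu> \<in> counting_measures Y. \<forall>A\<in>R. emeasure \<nu> A = c A}"

definition depends_on :: "'a measure \<Rightarrow> 'a set set \<Rightarrow> 'a measure set \<Rightarrow> bool" where
  "depends_on Y R E \<longleftrightarrow> E \<subseteq> counting_measures Y \<and>
     (\<forall>\<nu>\<in>counting_measures Y. \<forall>\<nu>'\<in>counting_measures Y.
        (\<forall>A\<in>R. emeasure \<nu> A = emeasure \<nu>' A) \<longrightarrow> \<nu> \<in> E \<longrightarrow> \<nu>' \<in> E)"

lemma cell_measurable [measurable]: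
  assumes "finite R" "R \<subseteq> sets Y"
  shows "cell Y R c \<in> sets (counting_measure_space Y)"
proof -
  have "{\<nu> \<in> space (counting_measure_space Y). \<forall>A\<in>R. emeasure \<nu> A = c A} \<in> sets (counting_measure_space Y)"
  proof (rule sets.sets_Collect_finite_All)
    fix A assume "A \<in> R"
    then have [measurable]: "A \<in> sets Y" using assms by auto
    show "{\<nu> \<in> space (counting_measure_space Y). emeasure \<nu> A = c A} \<in> sets (counting_measure_space Y)"
      by measurable
  qed (use assms in auto)
  then show ?thesis by (simp add: cell_def)
qed

text \<open>Counts take countably many values, so finitely many sets admit only countably many count
  profiles. Profiles are extensional functions: two distinct ones differ somewhere on
  \<open>R\<close>, which makes their cells disjoint.\<close>

lemma depends_on_cells:
  assumes R: "finite R" "R \<subseteq> sets Y" and E: "depends_on Y R E"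
  obtains I where "countable I" "I \<subseteq> R \<rightarrow>\<^sub>E (range of_nat \<union> {\<infinity>})"
    "E = (\<Union>c\<in>I. cell Y R c)" "disjoint_family_on (cell Y R) I"
proof
  let ?V = "range of_nat \<union> {\<infinity>} :: ennreal set"
  let ?I = "{c \<in> R \<rightarrow>\<^sub>E ?V. cell Y R c \<subseteq> E}"
  have "countable (R \<rightarrow>\<^sub>E ?V)"
    using R(1) by (intro countable_PiE) simp_all
  then show "countable ?I" by (rule countable_subset[rotated]) blast
  show "?I \<subseteq> R \<rightarrow>\<^sub>E ?V" by blast
  show "E = (\<Union>c\<in>?I. cell Y R c)"
  proof (intro equalityI subsetI)
    fix \<nu> assume \<nu>: "\<nu> \<in> E"
    then have \<nu>c: "\<nu> \<in> counting_measures Y" using E by (auto simp: depends_on_def)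
    let ?c = "\<lambda>A\<in>R. emeasure \<nu> A"
    have "?c \<in> R \<rightarrow>\<^sub>E ?V"
      unfolding restrict_PiE_iff using R(2) counting_measures_values[OF \<nu>c] by blast
    moreover have "cell Y R ?c \<subseteq> E"
      using E \<nu> \<nu>c by (auto simp: cell_def depends_on_def)
    moreover have "\<nu> \<in> cell Y R ?c" using \<nu>c by (auto simp: cell_def)
    ultimately show "\<nu> \<in> (\<Union>c\<in>?I. cell Y R c)" by blast
  qed blast
  show "disjoint_family_on (cell Y R) ?I"
    unfolding disjoint_family_on_def
  proof (intro ballI impI)
    fix c d assume cd: "c \<in> ?I" "d \<in> ?I" and ne: "c \<noteq> d"
    obtain A where "A \<in> R" "c A \<noteq> d A"
      using PiE_ext[of c R "\<lambda>_. ?V" d] cd ne by blast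
    then show "cell Y R c \<inter> cell Y R d = {}" by (auto simp: cell_def)
  qed
qed

lemma depends_on_measurable:
  assumes R: "finite R" "R \<subseteq> sets Y" and E: "depends_on Y R E"
  shows "E \<in> sets (counting_measure_space Y)"
proof -
  obtain I where "countable I" "E = (\<Union>c\<in>I. cell Y R c)"
    using depends_on_cells[OF assms] by metis
  then show ?thesis using R by (auto intro!: sets.countable_UN')
qed

lemma fine_partition_subset_sum:
  assumes R: "finite R" "R \<subseteq> sets Y" "disjoint R" and \<nu>: "\<nu> \<in> counting_measures Y"
    and A: "A = \<Union>{C\<in>R. C \<subseteq> A}"
  shows "emeasure \<nu> A = (\<Sum>C | C \<in> R \<and> C \<subseteq> A. emeasure \<nu> C)"
proof -
  have "(\<Sum>C | C \<in> R \<and> C \<subseteq> A. emeasure \<nu> (id C)) = emeasure \<nu> (\<Union>C\<in>{C\<in>R. C \<subseteq> A}. id C)"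
  proof (rule sum_emeasure)
    show "disjoint_family_on id {C \<in> R. C \<subseteq> A}"
      using R(3) by (auto simp: disjoint_family_on_def disjoint_def)
  qed (use R counting_measures_sets[OF \<nu>] in auto)
  then show ?thesis by (simp flip: A)
qed

text \<open>Counts on members of \<open>Q\<close> are finite sums of counts on members of
  \<open>R\<close>, so agreement on \<open>R\<close> forces agreement on \<open>Q\<close>.\<close>

lemma depends_on_refine:
  assumes R: "finite R" "R \<subseteq> sets Y" "disjoint R"
    and Q: "\<And>A. A \<in> Q \<Longrightarrow> A = \<Union>{C\<in>R. C \<subseteq> A}"
    and E: "depends_on Y Q E"
  shows "depends_on Y R E"
  unfolding depends_on_def
proof (intro conjI ballI impI)
  show "E \<subseteq> counting_measures Y" using E by (auto simp: depends_on_def)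
  fix \<nu> \<nu>' assume \<nu>: "\<nu> \<in> counting_measures Y" "\<nu>' \<in> counting_measures Y"
    and eq: "\<forall>A\<in>R. emeasure \<nu> A = emeasure \<nu>' A" and "\<nu> \<in> E"
  have "emeasure \<nu> A = emeasure \<nu>' A" if "A \<in> Q" for A
    using eq by (simp add: fine_partition_subset_sum[OF R \<nu>(1) Q[OF that]]
        fine_partition_subset_sum[OF R \<nu>(2) Q[OF that]])
  then show "\<nu>' \<in> E" using E \<nu> \<open>\<nu> \<in> E\<close> unfolding depends_on_def by blast
qed

lemma fine_partition_common_refinement:
  assumes Q: "fine_partition Y Z Q" and Q': "fine_partition Y Z Q'"
  defines "R \<equiv> (\<lambda>(A, B). A \<inter> B) ` (Q \<times> Q')"
  shows "fine_partition Y Z R"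
    and "A \<in> Q \<Longrightarrow> A = \<Union>{C\<in>R. C \<subseteq> A}" and "A \<in> Q' \<Longrightarrow> A = \<Union>{C\<in>R. C \<subseteq> A}"
proof -
  have "disjoint R"
    unfolding disjoint_def
  proof (intro ballI impI)
    fix C D assume "C \<in> R" "D \<in> R" and ne: "C \<noteq> D"
    then obtain A B A' B' where "C = A \<inter> B" "D = A' \<inter> B'" "A \<in> Q" "A' \<in> Q" "B \<in> Q'" "B' \<in> Q'"
      unfolding R_def by auto
    moreover have "A \<inter> A' = {} \<or> A = A'" "B \<inter> B' = {} \<or> B = B'"
      using Q Q' calculation unfolding fine_partition_def disjoint_def by metis+
    ultimately show "C \<inter> D = {}" using ne by auto
  qed
  moreover have "\<Union>R = \<Union>Q \<inter> \<Union>Q'" unfolding R_def by auto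
  moreover have "R \<subseteq> sets Y"
    using Q Q' unfolding R_def fine_partition_def by auto
  moreover have "\<forall>A\<in>R. A \<subseteq> Z \<or> A \<inter> Z = {}"
  proof
    fix C assume "C \<in> R"
    then obtain A B where "C = A \<inter> B" "A \<in> Q" unfolding R_def by auto
    then show "C \<subseteq> Z \<or> C \<inter> Z = {}" using Q unfolding fine_partition_def by blast
  qed
  ultimately show "fine_partition Y Z R"
    using Q Q' unfolding fine_partition_def by (simp add: R_def)
  show "A = \<Union>{C\<in>R. C \<subseteq> A}" if "A \<in> Q"
  proof (intro equalityI subsetI)
    fix x assume x: "x \<in> A"
    then have "x \<in> \<Union>Q'" using that Q Q' unfolding fine_partition_def by blast
    then obtain B where B: "B \<in> Q'" "x \<in> B" by blast
    then have "A \<inter> B \<in> R" using that unfolding R_def by (intro image_eqI[of _ _ "(A, B)"]) auto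
    then show "x \<in> \<Union>{C\<in>R. C \<subseteq> A}" using B x by blast
  qed auto
  show "A = \<Union>{C\<in>R. C \<subseteq> A}" if "A \<in> Q'"
  proof (intro equalityI subsetI)
    fix x assume x: "x \<in> A"
    then have "x \<in> \<Union>Q" using that Q Q' unfolding fine_partition_def by blast
    then obtain B where B: "B \<in> Q" "x \<in> B" by blast
    then have "B \<inter> A \<in> R" using that unfolding R_def by (intro image_eqI[of _ _ "(B, A)"]) auto
    then show "x \<in> \<Union>{C\<in>R. C \<subseteq> A}" using B x by blast
  qed auto
qed

lemma fine_partition_of_set:
  assumes "Z \<in> sets Y" "B \<in> sets Y"
  defines "R \<equiv> {B \<inter> Z, B - Z, Z - B, space Y - (B \<union> Z)}"
  shows "fine_partition Y Z R" and "B = \<Union>{C\<in>R. C \<subseteq> B}"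
proof -
  have sub: "B \<subseteq> space Y" "Z \<subseteq> space Y" using assms sets.sets_into_space by auto
  then have "\<Union>R = space Y" unfolding R_def by auto
  moreover have "disjoint R" unfolding R_def disjoint_def by auto
  ultimately show "fine_partition Y Z R"
    using assms(1,2) unfolding fine_partition_def by (auto simp: R_def)
  show "B = \<Union>{C\<in>R. C \<subseteq> B}" unfolding R_def by blast
qed

text \<open>Events determined by the counts on some partition compatible with \<open>Z\<close> form
  a generator that is intersection-stable by common refinement. Each is a countable disjoint union
  of cells, so agreement on cells carries over to it.\<close>

lemma counting_measure_space_eqI:
  assumes sets: "sets P = sets (counting_measure_space Y)" "sets Q = sets (counting_measure_space Y)"
    and fin: "emeasure P (space P) \<noteq> \<infinity>"
    and Z: "Z \<in> sets Y"
    and eq: "\<And>R c. fine_partition Y Z R \<Longrightarrow> c \<in> R \<rightarrow>\<^sub>E (range of_nat \<union> {\<infinity>}) \<Longrightarrow>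
      emeasure P (cell Y R c) = emeasure Q (cell Y R c)"
  shows "P = Q"
proof -
  define G where "G = {E. \<exists>R. fine_partition Y Z R \<and> depends_on Y R E}"
  have G_sets: "E \<in> sets (counting_measure_space Y)" if E: "E \<in> G" for E
  proof -
    obtain R where "fine_partition Y Z R" "depends_on Y R E" using E unfolding G_def by blast
    then show ?thesis unfolding fine_partition_def by (elim conjE) (rule depends_on_measurable)
  qed
  have gen: "sets (counting_measure_space Y) = sigma_sets (counting_measures Y) G"
  proof -
    let ?B = "{(\<lambda>\<mu>. emeasure \<mu> B) -` A \<inter> counting_measures Y |A B. A \<in> sets borel \<and> B \<in> sets Y}"
    have "?B \<subseteq> G"
    proof
      fix S assume "S \<in> ?B"
      then obtain A B where S: "S = (\<lambda>\<mu>. emeasure \<mu> B) -` A \<inter> counting_measures Y" and B: "B \<in> sets Y"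
        by auto
      note f = fine_partition_of_set[OF Z B]
      \<comment> \<open>\<open>{B}\<close> is not a partition of the space; the event is handed to
        the four pieces cut out by \<open>B\<close> and \<open>Z\<close>, on which the count of
        \<open>B\<close> is a sum.\<close>
      have "depends_on Y {B} S" unfolding depends_on_def S by auto
      then have "depends_on Y {B \<inter> Z, B - Z, Z - B, space Y - (B \<union> Z)} S"
      proof (rule depends_on_refine[rotated 4])
        fix A assume "A \<in> {B}"
        then have "A = B" by simp
        show "A = \<Union>{C\<in>{B \<inter> Z, B - Z, Z - B, space Y - (B \<union> Z)}. C \<subseteq> A}"
          unfolding \<open>A = B\<close> by (rule f(2))
      qed (use f(1) in \<open>simp_all only: fine_partition_def simp_thms\<close>)
      then show "S \<in> G" unfolding G_def using f(1) by blast
    qed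
    then have "sigma_sets (counting_measures Y) ?B \<subseteq> sigma_sets (counting_measures Y) G"
      by (rule sigma_sets_subseteq)
    moreover have "sets (counting_measure_space Y) = sigma_sets (counting_measures Y) ?B"
      unfolding counting_measure_space_def by (rule sets_measure_of) auto
    moreover have "sigma_sets (counting_measures Y) G \<subseteq> sets (counting_measure_space Y)"
      using sets.sigma_sets_subset[of G "counting_measure_space Y"] G_sets by auto
    ultimately show ?thesis by blast
  qed
  show ?thesis
  proof (rule measure_eqI_generator_eq)
    show "Int_stable G"
    proof (rule Int_stableI)
      fix E E' assume "E \<in> G" "E' \<in> G"
      then obtain Q Q' where Q: "fine_partition Y Z Q" "depends_on Y Q E"
        "fine_partition Y Z Q'" "depends_on Y Q' E'" unfolding G_def by blast
      define R where "R = (\<lambda>(A, B). A \<inter> B) ` (Q \<times> Q')"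
      note r = fine_partition_common_refinement[OF Q(1,3), folded R_def]
      have R: "finite R" "R \<subseteq> sets Y" "disjoint R" using r(1) unfolding fine_partition_def by auto
      have "depends_on Y R E" "depends_on Y R E'"
        using depends_on_refine[OF R r(2) Q(2)] depends_on_refine[OF R r(3) Q(4)] by auto
      then have "depends_on Y R (E \<inter> E')" unfolding depends_on_def by blast
      then show "E \<inter> E' \<in> G" using r(1) unfolding G_def by blast
    qed
    show "G \<subseteq> Pow (counting_measures Y)" unfolding G_def depends_on_def by auto
    show "emeasure P E = emeasure Q E" if "E \<in> G" for E
    proof -
      obtain R where R: "fine_partition Y Z R" "depends_on Y R E" using \<open>E \<in> G\<close> unfolding G_def by blast
      then have fin: "finite R" "R \<subseteq> sets Y" unfolding fine_partition_def by auto
      obtain I where I: "countable I" "I \<subseteq> R \<rightarrow>\<^sub>E (range of_nat \<union> {\<infinity>})"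
        "E = (\<Union>c\<in>I. cell Y R c)" "disjoint_family_on (cell Y R) I"
        using depends_on_cells[OF fin R(2)] by metis
      have "emeasure P E = (\<integral>\<^sup>+c. emeasure P (cell Y R c) \<partial>count_space I)"
        unfolding I(3) using I(1,4) fin by (intro emeasure_UN_countable) (simp_all add: sets cell_measurable)
      also have "\<dots> = (\<integral>\<^sup>+c. emeasure Q (cell Y R c) \<partial>count_space I)"
        using I(2) by (intro nn_integral_cong eq[OF R(1)]) (simp, blast)
      also have "\<dots> = emeasure Q E"
        unfolding I(3) using I(1,4) fin by (intro emeasure_UN_countable[symmetric]) (simp_all add: sets cell_measurable)
      finally show ?thesis .
    qed
    show "range (\<lambda>_::nat. counting_measures Y) \<subseteq> G"
    proof -
      have "depends_on Y {} (counting_measures Y)" unfolding depends_on_def by auto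
      \<comment> \<open>The four-piece partition taken at \<open>B = Z\<close> reduces to
        \<open>Z\<close>, its complement and the empty set, and is the witness for the whole
        space.\<close>
      then have "depends_on Y {Z \<inter> Z, Z - Z, Z - Z, space Y - (Z \<union> Z)} (counting_measures Y)"
        by (rule depends_on_refine[rotated 4])
          (use fine_partition_of_set(1)[OF Z Z] in \<open>simp_all only: fine_partition_def simp_thms empty_iff\<close>)
      then show ?thesis using fine_partition_of_set(1)[OF Z Z] unfolding G_def by blast
    qed
    have "space P = counting_measures Y"
      using sets_eq_imp_space_eq[OF sets(1)] by simp
    then show "\<And>i::nat. emeasure P (counting_measures Y) \<noteq> \<infinity>" using fin by simp
    show "sets P = sigma_sets (counting_measures Y) G" "sets Q = sigma_sets (counting_measures Y) G"
      by (simp_all only: gen[symmetric] sets)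
  qed blast
qed

section \<open>Association for a finite Poisson process added to a fixed measure\<close>

text \<open>The falling factorial divided by \<open>m ^ k\<close> is a product of \<open>k\<close>
  factors \<open>1 - i / m\<close>, each tending to one.\<close>

lemma tendsto_binomial_over_power:
  "(\<lambda>m. real (m choose k) / real m ^ k) \<longlonglongrightarrow> 1 / fact k"
proof -
  have "(\<lambda>m. (\<Prod>i=0..<k. 1 - real i / real m) / fact k) \<longlonglongrightarrow> (\<Prod>i=0..<k. 1 - 0) / fact k"
    by (intro tendsto_intros lim_const_over_n) auto
  moreover have "\<forall>\<^sub>F m in sequentially.
      (\<Prod>i=0..<k. 1 - real i / real m) / fact k = real (m choose k) / real m ^ k"
    using eventually_gt_at_top[of 0]
  proof eventually_elim
    case (elim m)
    have "(\<Prod>i=0..<k. 1 - real i / real m) = (\<Prod>i=0..<k. (real m - real i) / real m)"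
      using elim by (intro prod.cong) (auto simp: field_simps)
    also have "\<dots> = (\<Prod>i=0..<k. real m - real i) / real m ^ k"
      by (simp add: prod_dividef)
    finally show ?case
      by (simp add: binomial_gbinomial gbinomial_prod_rev)
  qed
  ultimately show ?thesis by (simp add: tendsto_cong)
qed

text \<open>Pascal's rule, read as conditioning on one of \<open>Suc m\<close> trials: weight
  \<open>q\<close> leaves \<open>u\<close> alone, weight \<open>p\<close> shifts it. The weights
  need not sum to one, because \<open>p\<close> will be \<open>1 / m\<close> while the mass of the
  intensity is absorbed into \<open>u\<close>.\<close>

lemma sum_binomial_Suc:
  fixes u :: "nat \<Rightarrow> real"
  shows "(\<Sum>k\<le>Suc m. real (Suc m choose k) * p ^ k * q ^ (Suc m - k) * u k) =
    q * (\<Sum>k\<le>m. real (m choose k) * p ^ k * q ^ (m - k) * u k) +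
    p * (\<Sum>k\<le>m. real (m choose k) * p ^ k * q ^ (m - k) * u (Suc k))"
proof -
  have "(\<Sum>k\<le>Suc m. real (Suc m choose k) * p ^ k * q ^ (Suc m - k) * u k) =
      q ^ Suc m * u 0 + (\<Sum>k\<le>m. real (m choose Suc k) * p ^ Suc k * q ^ (m - k) * u (Suc k)) +
      (\<Sum>k\<le>m. real (m choose k) * p ^ Suc k * q ^ (m - k) * u (Suc k))"
    unfolding sum.atMost_Suc_shift by (simp add: sum.distrib[symmetric] algebra_simps)
  also have "q ^ Suc m * u 0 + (\<Sum>k\<le>m. real (m choose Suc k) * p ^ Suc k * q ^ (m - k) * u (Suc k)) =
      (\<Sum>k\<le>Suc m. real (m choose k) * p ^ k * q ^ (Suc m - k) * u k)"
    unfolding sum.atMost_Suc_shift by simp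
  also have "\<dots> = q * (\<Sum>k\<le>m. real (m choose k) * p ^ k * q ^ (m - k) * u k)"
    by (simp add: binomial_eq_0 sum_distrib_left Suc_diff_le mult_ac cong: sum.cong_simp)
  also have "(\<Sum>k\<le>m. real (m choose k) * p ^ Suc k * q ^ (m - k) * u (Suc k)) =
      p * (\<Sum>k\<le>m. real (m choose k) * p ^ k * q ^ (m - k) * u (Suc k))"
    by (simp add: sum_distrib_left mult_ac)
  finally show ?thesis .
qed

text \<open>The classical Poisson limit with the powers of \<open>a\<close> moved from the weights
  into \<open>u\<close>, whence the growth bound. Since \<open>(m choose k) / m ^ k\<close> is at
  most \<open>1 / fact k\<close>, the series of \<open>C * a ^ k / fact k\<close> dominates and
  Tannery's theorem applies.\<close>

lemma poisson_limit:
  fixes u :: "nat \<Rightarrow> real"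
  assumes a: "a \<ge> 0" and u: "\<And>k. \<bar>u k\<bar> \<le> C * a ^ k"
  shows "(\<lambda>m. \<Sum>k\<le>m. real (m choose k) * (1 / real m) ^ k * (1 - a / real m) ^ (m - k) * u k)
    \<longlonglongrightarrow> exp (- a) * (\<Sum>k. u k / fact k)"
proof -
  define t where "t k m = (if k \<le> m then real (m choose k) * (1 / real m) ^ k * (1 - a / real m) ^ (m - k) * u k else 0)"
    for k m
  have lim: "(\<lambda>m. t k m) \<longlonglongrightarrow> exp (- a) * (u k / fact k)" for k
  proof -
    have "(\<lambda>m. real (m choose k) / real m ^ k * ((1 + (- a) / real m) ^ m / (1 - a / real m) ^ k) * u k)
        \<longlonglongrightarrow> 1 / fact k * (exp (- a) / (1 - 0) ^ k) * u k"
      by (intro tendsto_intros tendsto_binomial_over_power tendsto_exp_limit_sequentially lim_const_over_n) auto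
    moreover have "\<forall>\<^sub>F m in sequentially.
        real (m choose k) / real m ^ k * ((1 + (- a) / real m) ^ m / (1 - a / real m) ^ k) * u k = t k m"
      \<comment> \<open>Beyond \<open>a\<close> the base \<open>1 - a / m\<close> is nonzero, so the
        quotient of its powers is the power \<open>m - k\<close>.\<close>
      using eventually_ge_at_top[of k] eventually_gt_at_top[of "nat \<lceil>a\<rceil>"]
    proof eventually_elim
      case (elim m)
      then have "a < real m" by linarith
      then have "1 - a / real m \<noteq> 0" using a by (simp add: field_simps)
      then have "(1 - a / real m) ^ m / (1 - a / real m) ^ k = (1 - a / real m) ^ (m - k)"
        using elim by (simp add: power_diff)
      then show ?case using elim by (simp add: t_def divide_inverse power_inverse)
    qed
    ultimately show ?thesis by (simp add: tendsto_cong mult_ac)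
  qed
  have "\<forall>\<^sub>F m in sequentially. \<forall>k. norm (t k m) \<le> C * a ^ k / fact k"
    using eventually_gt_at_top[of "nat \<lceil>a\<rceil>"]
  proof eventually_elim
    case (elim m)
    then have am: "a < real m" by linarith
    show ?case
    proof
      fix k
      have C: "0 \<le> C * a ^ k" using u[of k] by linarith
      have "(m choose k) * fact k \<le> m ^ k" by (rule binomial_fact_pow)
      then have "real ((m choose k) * fact k) \<le> real (m ^ k)" by (rule of_nat_mono)
      then have 1: "real (m choose k) * (1 / real m) ^ k \<le> 1 / fact k"
        using am a by (simp add: field_simps power_one_over)
      have 2: "0 \<le> 1 - a / real m" "1 - a / real m \<le> 1" using am a by (auto simp: field_simps)
      then have 3: "(1 - a / real m) ^ (m - k) \<le> 1" by (simp add: power_le_one)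
      have "real (m choose k) * (1 / real m) ^ k * (1 - a / real m) ^ (m - k) * \<bar>u k\<bar> \<le> 1 / fact k * 1 * (C * a ^ k)"
        using 1 2 3 u[of k] by (intro mult_mono) auto
      then show "norm (t k m) \<le> C * a ^ k / fact k"
        using 2 C by (auto simp: t_def abs_mult)
    qed
  qed
  then have "\<forall>\<^sub>F (k, m) in at_top \<times>\<^sub>F sequentially. norm (t k m) \<le> C * a ^ k / fact k"
    unfolding eventually_prod_filter
    by (intro exI[of _ "\<lambda>_. True"] exI[of _ "\<lambda>m. \<forall>k. norm (t k m) \<le> C * a ^ k / fact k"]) auto
  moreover have "summable (\<lambda>k. C * a ^ k / fact k)"
    using summable_mult[OF summable_exp[of a], of C] by (simp add: field_simps)
  ultimately have "(\<lambda>m. \<Sum>k. t k m) \<longlonglongrightarrow> (\<Sum>k. exp (- a) * (u k / fact k))"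
    and s: "summable (\<lambda>k. norm (exp (- a) * (u k / fact k)))"
    using tannerys_theorem[of t, OF lim] by auto
  moreover have "(\<Sum>k. t k m) = (\<Sum>k\<le>m. real (m choose k) * (1 / real m) ^ k * (1 - a / real m) ^ (m - k) * u k)" for m
    by (subst suminf_finite[of "{..m}"]) (auto simp: t_def)
  moreover have "(\<Sum>k. exp (- a) * (u k / fact k)) = exp (- a) * (\<Sum>k. u k / fact k)"
    using summable_norm_cancel[OF s]
    by (intro suminf_mult summable_mult_D[of "exp (- a)" "\<lambda>k. u k / fact k"]) auto
  ultimately show ?thesis by simp
qed

section \<open>Functionals under random insertion of points\<close>

definition bounded_functional :: "'a measure \<Rightarrow> real \<Rightarrow> ('a measure \<Rightarrow> real) \<Rightarrow> bool" where
  "bounded_functional Y C f \<longleftrightarrow> f \<in> borel_measurable (counting_measure_space Y) \<and>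
     (\<forall>\<nu>\<in>counting_measures Y. \<bar>f \<nu>\<bar> \<le> C)"

lemma bounded_functional_mult:
  assumes "bounded_functional Y C f" "bounded_functional Y D g"
  shows "bounded_functional Y (C * D) (\<lambda>\<nu>. f \<nu> * g \<nu>)"
  using assms unfolding bounded_functional_def
  by (auto simp: abs_mult intro!: mult_mono intro: order_trans[OF abs_ge_zero])

lemma bounded_functional_indicator:
  "A \<in> sets (counting_measure_space Y) \<Longrightarrow> bounded_functional Y 1 (indicator A)"
  by (auto simp: bounded_functional_def indicator_def)

definition mixed_monotone :: "'a measure \<Rightarrow> 'a set \<Rightarrow> ('a measure \<Rightarrow> real) \<Rightarrow> bool" where
  "mixed_monotone Y B f \<longleftrightarrow> increasing_on Y B f \<and> decreasing_on Y (space Y - B) f"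

locale finite_intensity = finite_measure l for l :: "'a measure" +
  fixes Y :: "'a measure"
  assumes sets_l [simp, measurable_cong]: "sets l = sets Y"
begin

abbreviation total :: real where "total \<equiv> measure l (space l)"

text \<open>The intensity is not normalised: the \<open>n\<close>-th iterate already carries the
  factor \<open>total ^ n\<close> of a Poisson weight, and no division by a possibly zero mass
  occurs.\<close>

definition insert_point :: "('a measure \<Rightarrow> real) \<Rightarrow> 'a measure \<Rightarrow> real" where
  "insert_point f \<nu> = (\<integral>x. f (add_measure \<nu> (return Y x)) \<partial>l)"

text \<open>One step of the approximation: with probability \<open>p * total\<close> add a point with distribution
  \<open>l / total\<close>. The \<open>m\<close>-th iterate with \<open>p = 1 / m\<close> converges to adding a Poisson process.\<close>
definition add_bernoulli :: "real \<Rightarrow> ('a measure \<Rightarrow> real) \<Rightarrow> 'a measure \<Rightarrow> real" where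
  "add_bernoulli p f \<nu> = (1 - p * total) * f \<nu> + p * insert_point f \<nu>"

text \<open>The exponential series of \<open>insert_point\<close>, normalised by
  \<open>exp (- total)\<close>: the mean of \<open>f\<close> after a Poisson process of intensity
  \<open>l\<close> has been added to \<open>\<nu>\<close>.\<close>

definition add_poisson :: "('a measure \<Rightarrow> real) \<Rightarrow> 'a measure \<Rightarrow> real" where
  "add_poisson f \<nu> = exp (- total) * (\<Sum>n. (insert_point ^^ n) f \<nu> / fact n)"

lemma space_l [simp]: "space l = space Y"
  by (rule sets_eq_imp_space_eq) simp

lemma measurable_add_point_l:
  assumes "\<nu> \<in> counting_measures Y"
  shows "(\<lambda>x. add_measure \<nu> (return Y x)) \<in> measurable l (counting_measure_space Y)"
proof -
  have "(\<lambda>x. (\<nu>, x)) \<in> measurable l (counting_measure_space Y \<Otimes>\<^sub>M Y)"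
    using assms by (intro measurable_Pair) auto
  from measurable_compose[OF this measurable_add_point] show ?thesis by simp
qed

lemma integrable_add_point:
  assumes f: "bounded_functional Y C f" and \<nu>: "\<nu> \<in> counting_measures Y"
  shows "integrable l (\<lambda>x. f (add_measure \<nu> (return Y x)))"
proof (rule integrable_const_bound[of _ C])
  show "AE x in l. norm (f (add_measure \<nu> (return Y x))) \<le> C"
    using f add_dirac_in_counting_measures[OF \<nu>] by (auto simp: bounded_functional_def)
  show "(\<lambda>x. f (add_measure \<nu> (return Y x))) \<in> borel_measurable l"
    using f by (intro measurable_compose[OF measurable_add_point_l[OF \<nu>]]) (simp add: bounded_functional_def)
qed

lemma insert_point_measurable:
  assumes [measurable]: "f \<in> borel_measurable (counting_measure_space Y)"
  shows "insert_point f \<in> borel_measurable (counting_measure_space Y)"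
proof -
  have "(\<lambda>(\<nu>, x). add_measure \<nu> (return Y x)) \<in>
     measurable (counting_measure_space Y \<Otimes>\<^sub>M l) (counting_measure_space Y)"
    using measurable_add_point[of Y] by (simp cong: measurable_cong_sets add: sets_pair_measure_cong[OF refl sets_l])
  from measurable_compose[OF this assms]
  have "(\<lambda>\<nu>. \<integral>x. f (add_measure \<nu> (return Y x)) \<partial>l) \<in> borel_measurable (counting_measure_space Y)"
    by (intro borel_measurable_lebesgue_integral) (simp add: case_prod_beta')
  then show ?thesis by (simp add: insert_point_def[abs_def])
qed

lemma insert_point_bounded:
  assumes f: "bounded_functional Y C f"
  shows "bounded_functional Y (C * total) (insert_point f)"
  unfolding bounded_functional_def
proof (intro conjI ballI)
  show "insert_point f \<in> borel_measurable (counting_measure_space Y)"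
    using f by (intro insert_point_measurable) (simp add: bounded_functional_def)
  fix \<nu> assume \<nu>: "\<nu> \<in> counting_measures Y"
  have "\<bar>insert_point f \<nu>\<bar> \<le> (\<integral>x. \<bar>f (add_measure \<nu> (return Y x))\<bar> \<partial>l)"
    unfolding insert_point_def by (rule integral_abs_bound)
  also have "\<dots> \<le> (\<integral>x. C \<partial>l)"
    using f integrable_add_point[OF f \<nu>] add_dirac_in_counting_measures[OF \<nu>]
    by (intro integral_mono) (auto simp: bounded_functional_def)
  finally show "\<bar>insert_point f \<nu>\<bar> \<le> C * total" by (simp add: mult.commute)
qed

lemma funpow_insert_point_bounded:
  "bounded_functional Y C f \<Longrightarrow> bounded_functional Y (C * total ^ n) ((insert_point ^^ n) f)"
proof (induction n)
  case (Suc n)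
  from insert_point_bounded[OF Suc.IH[OF Suc.prems]] show ?case by (simp add: mult_ac)
qed simp

lemma insert_point_cong:
  assumes "\<nu> \<in> counting_measures Y" "\<And>\<nu>. \<nu> \<in> counting_measures Y \<Longrightarrow> f \<nu> = g \<nu>"
  shows "insert_point f \<nu> = insert_point g \<nu>"
  unfolding insert_point_def
  by (intro Bochner_Integration.integral_cong refl assms(2) add_dirac_in_counting_measures[OF assms(1)]) simp

lemma insert_point_sum:
  assumes "\<And>k. k \<in> I \<Longrightarrow> bounded_functional Y (C k) (F k)" "\<nu> \<in> counting_measures Y"
  shows "insert_point (\<lambda>\<nu>. \<Sum>k\<in>I. c k * F k \<nu>) \<nu> = (\<Sum>k\<in>I. c k * insert_point (F k) \<nu>)"
  unfolding insert_point_def using integrable_add_point[OF assms(1) assms(2)]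
  by (subst Bochner_Integration.integral_sum) auto

lemma add_bernoulli_bounded:
  assumes f: "bounded_functional Y C f" and p: "0 \<le> p" "p * total \<le> 1"
  shows "bounded_functional Y C (add_bernoulli p f)"
  unfolding bounded_functional_def
proof (intro conjI ballI)
  have [measurable]: "f \<in> borel_measurable (counting_measure_space Y)"
    using f by (simp add: bounded_functional_def)
  note [measurable] = insert_point_measurable[OF this]
  show "add_bernoulli p f \<in> borel_measurable (counting_measure_space Y)"
    unfolding add_bernoulli_def[abs_def] by measurable
  fix \<nu> assume \<nu>: "\<nu> \<in> counting_measures Y"
  have 1: "\<bar>f \<nu>\<bar> \<le> C" "\<bar>insert_point f \<nu>\<bar> \<le> C * total"
    using f insert_point_bounded[OF f] \<nu> by (auto simp: bounded_functional_def)
  have "\<bar>add_bernoulli p f \<nu>\<bar> \<le> \<bar>(1 - p * total) * f \<nu>\<bar> + \<bar>p * insert_point f \<nu>\<bar>"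
    unfolding add_bernoulli_def by (rule abs_triangle_ineq)
  also have "\<dots> = (1 - p * total) * \<bar>f \<nu>\<bar> + p * \<bar>insert_point f \<nu>\<bar>"
    using p by (simp add: abs_mult)
  also have "\<dots> \<le> (1 - p * total) * C + p * (C * total)"
    using 1 p by (intro add_mono mult_left_mono) auto
  also have "\<dots> = C" by (simp add: algebra_simps)
  finally show "\<bar>add_bernoulli p f \<nu>\<bar> \<le> C" .
qed

lemma funpow_add_bernoulli_bounded:
  assumes "bounded_functional Y C f" "0 \<le> p" "p * total \<le> 1"
  shows "bounded_functional Y C ((add_bernoulli p ^^ m) f)"
  by (induction m) (auto intro!: add_bernoulli_bounded assms simp del: space_l)

text \<open>Scaling and insertion are linear and commute, so the iterates expand like a binomial
  power.\<close>

lemma funpow_add_bernoulli: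
  assumes f: "bounded_functional Y C f" and \<nu>: "\<nu> \<in> counting_measures Y"
  shows "(add_bernoulli p ^^ m) f \<nu> =
    (\<Sum>k\<le>m. real (m choose k) * p ^ k * (1 - p * total) ^ (m - k) * (insert_point ^^ k) f \<nu>)"
  using \<nu>
proof (induction m arbitrary: \<nu>)
  case (Suc m)
  let ?c = "\<lambda>k. real (m choose k) * p ^ k * (1 - p * total) ^ (m - k)"
  have "insert_point ((add_bernoulli p ^^ m) f) \<nu> =
      insert_point (\<lambda>\<nu>. \<Sum>k\<le>m. ?c k * (insert_point ^^ k) f \<nu>) \<nu>"
    using Suc by (intro insert_point_cong) auto
  also have "\<dots> = (\<Sum>k\<le>m. ?c k * (insert_point ^^ Suc k) f \<nu>)"
    using Suc.prems by (subst insert_point_sum[OF funpow_insert_point_bounded[OF f]]) auto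
  finally show ?case
    unfolding sum_binomial_Suc using Suc.IH[OF Suc.prems]
    by (simp add: add_bernoulli_def[of p "(add_bernoulli p ^^ m) f"])
qed simp

lemma add_poisson_limit:
  assumes f: "bounded_functional Y C f" and \<nu>: "\<nu> \<in> counting_measures Y"
  shows "(\<lambda>m. (add_bernoulli (1 / real m) ^^ m) f \<nu>) \<longlonglongrightarrow> add_poisson f \<nu>"
proof -
  have "\<bar>(insert_point ^^ k) f \<nu>\<bar> \<le> C * total ^ k" for k
    using funpow_insert_point_bounded[OF f] \<nu> by (auto simp: bounded_functional_def)
  from poisson_limit[OF _ this] show ?thesis
    by (simp add: funpow_add_bernoulli[OF f \<nu>] add_poisson_def)
qed

text \<open>The weights of a step are nonnegative and sum to one, so it respects inequalities and
  lets an additive constant through unchanged. This is why errors from earlier steps do not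
  grow.\<close>

lemma add_bernoulli_mono:
  assumes f: "bounded_functional Y C f" and g: "bounded_functional Y D g"
    and p: "0 \<le> p" "p * total \<le> 1" and \<nu>: "\<nu> \<in> counting_measures Y"
    and le: "\<And>\<nu>. \<nu> \<in> counting_measures Y \<Longrightarrow> f \<nu> \<le> g \<nu> + c"
  shows "add_bernoulli p f \<nu> \<le> add_bernoulli p g \<nu> + c"
proof -
  have "insert_point f \<nu> \<le> (\<integral>x. g (add_measure \<nu> (return Y x)) + c \<partial>l)"
    unfolding insert_point_def
    using integrable_add_point[OF f \<nu>] integrable_add_point[OF g \<nu>]
    by (intro integral_mono le) (auto intro: add_dirac_in_counting_measures[OF \<nu>])
  also have "\<dots> = insert_point g \<nu> + c * total"
    unfolding insert_point_def using integrable_add_point[OF g \<nu>] by simp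
  finally have "p * insert_point f \<nu> \<le> p * (insert_point g \<nu> + c * total)"
    using p by (intro mult_left_mono)
  moreover have "(1 - p * total) * f \<nu> \<le> (1 - p * total) * (g \<nu> + c)"
    using p le[OF \<nu>] by (intro mult_left_mono) auto
  ultimately show ?thesis unfolding add_bernoulli_def by (simp add: algebra_simps)
qed

text \<open>Adding \<open>x\<close> and adding \<open>y\<close> commute, so the increment at
  \<open>y\<close> of the averaged functional is an average of increments of \<open>f\<close> at
  \<open>y\<close>, all of the same sign.\<close>

lemma add_bernoulli_mixed_monotone:
  assumes f: "bounded_functional Y C f" and m: "mixed_monotone Y B f" and B: "B \<in> sets Y"
    and p: "0 \<le> p" "p * total \<le> 1"
  shows "mixed_monotone Y B (add_bernoulli p f)"
proof -
  have BY: "B \<subseteq> space Y" using B by (rule sets.sets_into_space)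
  have ins: "insert_point f (add_measure \<nu> (return Y y)) =
      (\<integral>x. f (add_measure (add_measure \<nu> (return Y x)) (return Y y)) \<partial>l)"
    if "\<nu> \<in> counting_measures Y" "y \<in> space Y" for \<nu> y
    unfolding insert_point_def using that
    by (intro Bochner_Integration.integral_cong) (auto simp: add_point_commute)
  have int: "integrable l (\<lambda>x. f (add_measure (add_measure \<nu> (return Y x)) (return Y y)))"
    if "\<nu> \<in> counting_measures Y" "y \<in> space Y" for \<nu> y
    using integrable_add_point[OF f add_dirac_in_counting_measures[OF that]] that
    by (subst Bochner_Integration.integrable_cong[OF refl]) (auto simp: add_point_commute)
  note cm = add_dirac_in_counting_measures
  have "add_bernoulli p f \<nu> \<le> add_bernoulli p f (add_measure \<nu> (return Y y))"
    if \<nu>: "\<nu> \<in> counting_measures Y" and y: "y \<in> B" for \<nu> y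
  proof -
    have y': "y \<in> space Y" using y BY by auto
    have "insert_point f \<nu> \<le> insert_point f (add_measure \<nu> (return Y y))"
      unfolding ins[OF \<nu> y'] unfolding insert_point_def
      using integrable_add_point[OF f \<nu>] int[OF \<nu> y'] m y cm[OF \<nu>]
      by (intro integral_mono) (auto simp: mixed_monotone_def increasing_on_def)
    moreover have "f \<nu> \<le> f (add_measure \<nu> (return Y y))"
      using m y \<nu> by (auto simp: mixed_monotone_def increasing_on_def)
    ultimately show ?thesis
      using p unfolding add_bernoulli_def by (intro add_mono mult_left_mono) auto
  qed
  moreover have "add_bernoulli p f (add_measure \<nu> (return Y y)) \<le> add_bernoulli p f \<nu>"
    if \<nu>: "\<nu> \<in> counting_measures Y" and y: "y \<in> space Y - B" for \<nu> y
  proof -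
    have y': "y \<in> space Y" using y by auto
    have "insert_point f (add_measure \<nu> (return Y y)) \<le> insert_point f \<nu>"
      unfolding ins[OF \<nu> y'] unfolding insert_point_def
      using integrable_add_point[OF f \<nu>] int[OF \<nu> y'] m y cm[OF \<nu>]
      by (intro integral_mono) (auto simp: mixed_monotone_def increasing_on_def decreasing_on_def)
    moreover have "f (add_measure \<nu> (return Y y)) \<le> f \<nu>"
      using m y \<nu> by (auto simp: mixed_monotone_def increasing_on_def decreasing_on_def)
    ultimately show ?thesis
      using p unfolding add_bernoulli_def by (intro add_mono mult_left_mono) auto
  qed
  ultimately show ?thesis by (auto simp: mixed_monotone_def increasing_on_def decreasing_on_def)
qed

lemma funpow_add_bernoulli_mixed_monotone:
  assumes "bounded_functional Y C f" "mixed_monotone Y B f" "B \<in> sets Y" "0 \<le> p" "p * total \<le> 1"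
  shows "mixed_monotone Y B ((add_bernoulli p ^^ m) f)"
proof (induction m)
  case (Suc m)
  show ?case unfolding funpow.simps o_apply
    by (rule add_bernoulli_mixed_monotone[OF funpow_add_bernoulli_bounded Suc]) (fact assms)+
qed (simp add: assms)

text \<open>The increments \<open>h x = f (\<nu> + \<delta>\<^sub>x) - f \<nu>\<close> and \<open>k x = g (\<nu> + \<delta>\<^sub>x) - g \<nu>\<close> have equal signs, so the
  covariance \<open>p * \<integral>h k - p\<^sup>2 * (\<integral>h) * (\<integral>k)\<close> of a single step is negative at most to second order in \<open>p\<close>.\<close>
lemma add_bernoulli_mult:
  assumes f: "bounded_functional Y C f" "mixed_monotone Y B f"
    and g: "bounded_functional Y C g" "mixed_monotone Y B g"
    and p: "0 \<le> p" and \<nu>: "\<nu> \<in> counting_measures Y"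
  shows "add_bernoulli p f \<nu> * add_bernoulli p g \<nu> \<le>
    add_bernoulli p (\<lambda>\<nu>. f \<nu> * g \<nu>) \<nu> + p\<^sup>2 * (2 * C * total)\<^sup>2"
proof -
  define F where "F = (\<lambda>x. f (add_measure \<nu> (return Y x)))"
  define G where "G = (\<lambda>x. g (add_measure \<nu> (return Y x)))"
  define h where "h x = F x - f \<nu>" for x
  define k where "k x = G x - g \<nu>" for x
  have int [simp]: "integrable l F" "integrable l G" "integrable l (\<lambda>x. F x * G x)"
    using integrable_add_point[OF f(1) \<nu>] integrable_add_point[OF g(1) \<nu>]
      integrable_add_point[OF bounded_functional_mult[OF f(1) g(1)] \<nu>]
    by (auto simp: F_def G_def)
  have eq: "insert_point f \<nu> = (\<integral>x. F x \<partial>l)" "insert_point g \<nu> = (\<integral>x. G x \<partial>l)"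
    "insert_point (\<lambda>\<nu>. f \<nu> * g \<nu>) \<nu> = (\<integral>x. F x * G x \<partial>l)"
    by (auto simp: insert_point_def F_def G_def)
  have Ih: "(\<integral>x. h x \<partial>l) = (\<integral>x. F x \<partial>l) - f \<nu> * total"
    and Ik: "(\<integral>x. k x \<partial>l) = (\<integral>x. G x \<partial>l) - g \<nu> * total"
    by (auto simp: h_def k_def)
  have hk: "h x * k x = F x * G x - g \<nu> * F x - f \<nu> * G x + f \<nu> * g \<nu>" for x
    by (simp add: h_def k_def algebra_simps)
  have Ihk: "(\<integral>x. h x * k x \<partial>l) =
      (\<integral>x. F x * G x \<partial>l) - g \<nu> * (\<integral>x. F x \<partial>l) - f \<nu> * (\<integral>x. G x \<partial>l) + f \<nu> * g \<nu> * total"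
    unfolding hk by simp
  have "0 \<le> h x * k x" if "x \<in> space Y" for x
  proof (cases "x \<in> B")
    case True
    then have "0 \<le> h x" "0 \<le> k x" using f(2) g(2) \<nu>
      by (auto simp: mixed_monotone_def increasing_on_def h_def k_def F_def G_def)
    then show ?thesis by simp
  next
    case False
    then have "h x \<le> 0" "k x \<le> 0" using f(2) g(2) \<nu> that
      by (auto simp: mixed_monotone_def increasing_on_def decreasing_on_def h_def k_def F_def G_def)
    then show ?thesis by (rule mult_nonpos_nonpos)
  qed
  then have 1: "0 \<le> (\<integral>x. h x * k x \<partial>l)" by (intro integral_nonneg_AE) auto
  have bd: "\<bar>insert_point f \<nu>\<bar> \<le> C * total" "\<bar>f \<nu>\<bar> \<le> C" "\<bar>insert_point g \<nu>\<bar> \<le> C * total" "\<bar>g \<nu>\<bar> \<le> C"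
    using f(1) g(1) insert_point_bounded[OF f(1)] insert_point_bounded[OF g(1)] \<nu>
    by (auto simp: bounded_functional_def)
  have "\<bar>f \<nu> * total\<bar> \<le> C * total" "\<bar>g \<nu> * total\<bar> \<le> C * total"
    using bd by (auto simp: abs_mult intro!: mult_right_mono)
  then have "\<bar>\<integral>x. h x \<partial>l\<bar> \<le> 2 * C * total" "\<bar>\<integral>x. k x \<partial>l\<bar> \<le> 2 * C * total"
    using bd unfolding Ih Ik eq by linarith+
  then have "\<bar>\<integral>x. h x \<partial>l\<bar> * \<bar>\<integral>x. k x \<partial>l\<bar> \<le> (2 * C * total) * (2 * C * total)"
    by (intro mult_mono) auto
  then have "(\<integral>x. h x \<partial>l) * (\<integral>x. k x \<partial>l) \<le> (2 * C * total)\<^sup>2"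
    unfolding power2_eq_square abs_mult[symmetric] by linarith
  then have 2: "p\<^sup>2 * ((\<integral>x. h x \<partial>l) * (\<integral>x. k x \<partial>l)) \<le> p\<^sup>2 * (2 * C * total)\<^sup>2"
    by (intro mult_left_mono) auto
  have "add_bernoulli p f \<nu> * add_bernoulli p g \<nu> = add_bernoulli p (\<lambda>\<nu>. f \<nu> * g \<nu>) \<nu>
      - p * (\<integral>x. h x * k x \<partial>l) + p\<^sup>2 * ((\<integral>x. h x \<partial>l) * (\<integral>x. k x \<partial>l))"
    unfolding add_bernoulli_def eq Ih Ik Ihk by (simp add: algebra_simps power2_eq_square)
  moreover have "0 \<le> p * (\<integral>x. h x * k x \<partial>l)" using 1 p by simp
  ultimately show ?thesis using 2 by linarith
qed

text \<open>The one-step inequality is applied to the iterates of \<open>f\<close> and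
  \<open>g\<close>, which keep the bound \<open>C\<close> and the mixed monotonicity; the error
  accumulated so far is a constant and survives the next average as it is.\<close>

lemma funpow_add_bernoulli_mult:
  assumes f: "bounded_functional Y C f" "mixed_monotone Y B f"
    and g: "bounded_functional Y C g" "mixed_monotone Y B g" and B: "B \<in> sets Y"
    and p: "0 \<le> p" "p * total \<le> 1" and \<nu>: "\<nu> \<in> counting_measures Y"
  shows "(add_bernoulli p ^^ m) f \<nu> * (add_bernoulli p ^^ m) g \<nu> \<le>
    (add_bernoulli p ^^ m) (\<lambda>\<nu>. f \<nu> * g \<nu>) \<nu> + real m * (p\<^sup>2 * (2 * C * total)\<^sup>2)"
  using \<nu>
proof (induction m arbitrary: \<nu>)
  case (Suc m)
  let ?f = "(add_bernoulli p ^^ m) f" and ?g = "(add_bernoulli p ^^ m) g"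
  note bdd = funpow_add_bernoulli_bounded[OF _ p] and mon = funpow_add_bernoulli_mixed_monotone[OF _ _ B p]
  have "add_bernoulli p ?f \<nu> * add_bernoulli p ?g \<nu> \<le>
      add_bernoulli p (\<lambda>\<nu>. ?f \<nu> * ?g \<nu>) \<nu> + p\<^sup>2 * (2 * C * total)\<^sup>2"
    using f g p(1) Suc.prems by (intro add_bernoulli_mult[of _ _ B] bdd mon)
  also have "add_bernoulli p (\<lambda>\<nu>. ?f \<nu> * ?g \<nu>) \<nu> \<le>
      add_bernoulli p ((add_bernoulli p ^^ m) (\<lambda>\<nu>. f \<nu> * g \<nu>)) \<nu> + real m * (p\<^sup>2 * (2 * C * total)\<^sup>2)"
    using f g p Suc by (intro add_bernoulli_mono[of "C * C" _ "C * C"] bdd bounded_functional_mult)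
  finally show ?case by (simp add: algebra_simps)
qed simp

lemma add_poisson_mult:
  assumes f: "bounded_functional Y C f" "mixed_monotone Y B f"
    and g: "bounded_functional Y C g" "mixed_monotone Y B g" and B: "B \<in> sets Y"
    and \<nu>: "\<nu> \<in> counting_measures Y"
  shows "add_poisson f \<nu> * add_poisson g \<nu> \<le> add_poisson (\<lambda>\<nu>. f \<nu> * g \<nu>) \<nu>"
proof (rule LIMSEQ_le)
  let ?D = "(2 * C * total)\<^sup>2"
  show "(\<lambda>m. (add_bernoulli (1 / real m) ^^ m) f \<nu> * (add_bernoulli (1 / real m) ^^ m) g \<nu>)
      \<longlonglongrightarrow> add_poisson f \<nu> * add_poisson g \<nu>"
    by (intro tendsto_mult add_poisson_limit[OF f(1) \<nu>] add_poisson_limit[OF g(1) \<nu>])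
  have "(\<lambda>m. (add_bernoulli (1 / real m) ^^ m) (\<lambda>\<nu>. f \<nu> * g \<nu>) \<nu> + ?D / real m)
      \<longlonglongrightarrow> add_poisson (\<lambda>\<nu>. f \<nu> * g \<nu>) \<nu> + 0"
    by (intro tendsto_add add_poisson_limit[OF bounded_functional_mult[OF f(1) g(1)] \<nu>] lim_const_over_n)
  then show "(\<lambda>m. (add_bernoulli (1 / real m) ^^ m) (\<lambda>\<nu>. f \<nu> * g \<nu>) \<nu> + ?D / real m)
      \<longlonglongrightarrow> add_poisson (\<lambda>\<nu>. f \<nu> * g \<nu>) \<nu>" by simp
  show "\<exists>N. \<forall>m\<ge>N. (add_bernoulli (1 / real m) ^^ m) f \<nu> * (add_bernoulli (1 / real m) ^^ m) g \<nu> \<le>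
      (add_bernoulli (1 / real m) ^^ m) (\<lambda>\<nu>. f \<nu> * g \<nu>) \<nu> + ?D / real m"
  \<comment> \<open>From this index on \<open>1 / m * total \<le> 1\<close>, so every step is a
    genuine probability mixture.\<close>
  proof (intro exI[of _ "Suc (nat \<lceil>total\<rceil>)"] allI impI)
    fix m :: nat assume "Suc (nat \<lceil>total\<rceil>) \<le> m"
    then have m: "0 < m" "total \<le> real m" by linarith+
    then have "1 / real m * total \<le> 1" by (simp add: field_simps)
    moreover have "real m * ((1 / real m)\<^sup>2 * ?D) = ?D / real m"
      using m by (simp add: power2_eq_square field_simps)
    ultimately show "(add_bernoulli (1 / real m) ^^ m) f \<nu> * (add_bernoulli (1 / real m) ^^ m) g \<nu> \<le>
      (add_bernoulli (1 / real m) ^^ m) (\<lambda>\<nu>. f \<nu> * g \<nu>) \<nu> + ?D / real m"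
      using funpow_add_bernoulli_mult[OF f g B _ _ \<nu>, of "1 / real m" m] by simp
  qed
qed

end

section \<open>Superposition with a finite Poisson process\<close>

text \<open>\<open>N\<close> contributes only its space and sigma-field.\<close>

definition sum_measure :: "'b measure \<Rightarrow> (nat \<Rightarrow> 'b measure) \<Rightarrow> 'b measure" where
  "sum_measure N \<mu> = measure_of (space N) (sets N) (\<lambda>A. \<Sum>n. emeasure (\<mu> n) A)"

lemma sets_sum_measure [simp]: "sets (sum_measure N \<mu>) = sets N"
  by (simp add: sum_measure_def)

lemma emeasure_sum_measure:
  assumes sets: "\<And>n. sets (\<mu> n) = sets N" and A: "A \<in> sets N"
  shows "emeasure (sum_measure N \<mu>) A = (\<Sum>n. emeasure (\<mu> n) A)"
proof (rule emeasure_measure_of[OF sum_measure_def])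
  show "countably_additive (sets (sum_measure N \<mu>)) (\<lambda>A. \<Sum>n. emeasure (\<mu> n) A)"
    unfolding countably_additive_def
  proof (intro allI impI)
    fix F :: "nat \<Rightarrow> _"
    assume F: "range F \<subseteq> sets (sum_measure N \<mu>)" "disjoint_family F"
    have "(\<Sum>i. \<Sum>n. emeasure (\<mu> n) (F i)) = (\<Sum>i. \<integral>\<^sup>+n. emeasure (\<mu> n) (F i) \<partial>count_space UNIV)"
      by (simp add: nn_integral_count_space_nat)
    also have "\<dots> = (\<integral>\<^sup>+n. (\<Sum>i. emeasure (\<mu> n) (F i)) \<partial>count_space UNIV)"
      by (rule nn_integral_suminf[symmetric]) simp
    also have "\<dots> = (\<integral>\<^sup>+n. emeasure (\<mu> n) (\<Union>(range F)) \<partial>count_space UNIV)"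
      using F sets by (intro nn_integral_cong suminf_emeasure) auto
    finally show "(\<Sum>i. \<Sum>n. emeasure (\<mu> n) (F i)) = (\<Sum>n. emeasure (\<mu> n) (\<Union>(range F)))"
      by (simp add: nn_integral_count_space_nat)
  qed
qed (use A sets.space_closed in \<open>auto simp: positive_def\<close>)

lemma nn_integral_sum_measure:
  assumes sets: "\<And>n. sets (\<mu> n) = sets N" and u: "u \<in> borel_measurable N"
  shows "(\<integral>\<^sup>+x. u x \<partial>sum_measure N \<mu>) = (\<Sum>n. \<integral>\<^sup>+x. u x \<partial>\<mu> n)"
  using u
proof (induction rule: borel_measurable_induct)
  have m: "f \<in> borel_measurable (sum_measure N \<mu>)" "f \<in> borel_measurable (\<mu> n)"
    if "f \<in> borel_measurable N" for f :: "_ \<Rightarrow> ennreal" and n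
    using that by (simp_all add: sets cong: measurable_cong_sets)
  have sp: "space (sum_measure N \<mu>) = space N" "space (\<mu> n) = space N" for n
    by (auto intro!: sets_eq_imp_space_eq sets)
  {
    case (cong f g)
    have e1: "(\<integral>\<^sup>+x. f x \<partial>sum_measure N \<mu>) = (\<integral>\<^sup>+x. g x \<partial>sum_measure N \<mu>)"
      using cong(3) by (intro nn_integral_cong) (simp add: sp)
    have e2: "(\<integral>\<^sup>+x. f x \<partial>\<mu> n) = (\<integral>\<^sup>+x. g x \<partial>\<mu> n)" for n
      using cong(3) by (intro nn_integral_cong) (simp add: sp)
    show ?case unfolding e1 e2 by (rule cong(4))
  next
    case (set A)
    then show ?case using sets by (simp add: emeasure_sum_measure)
  next
    case (mult u c)
    then show ?case by (simp add: m nn_integral_cmult)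
  next
    case (add u v)
    then show ?case by (simp add: m nn_integral_add suminf_add)
  next
    case (seq U)
    have inc: "incseq (\<lambda>i. \<integral>\<^sup>+x. U i x \<partial>\<mu> n)" for n
      using seq(3) by (auto simp: incseq_def le_fun_def intro!: nn_integral_mono)
    have eq: "Sup (range U) = (\<lambda>x. SUP i. U i x)" by (auto simp: fun_eq_iff image_comp)
    have "(\<integral>\<^sup>+x. (SUP i. U i x) \<partial>sum_measure N \<mu>) = (SUP i. \<Sum>n. \<integral>\<^sup>+x. U i x \<partial>\<mu> n)"
      using seq by (subst nn_integral_monotone_convergence_SUP) (auto simp: m)
    also have "\<dots> = (\<Sum>n. SUP i. \<integral>\<^sup>+x. U i x \<partial>\<mu> n)"
      using inc by (intro ennreal_suminf_SUP_eq[symmetric]) (auto simp: incseq_def)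
    also have "\<dots> = (\<Sum>n. \<integral>\<^sup>+x. (SUP i. U i x) \<partial>\<mu> n)"
      using seq by (subst nn_integral_monotone_convergence_SUP) (auto simp: m)
    finally show ?case unfolding eq .
  }
qed

section \<open>Laws of randomly augmented counting measures\<close>

context finite_intensity
begin

text \<open>The action on measures dual to iterating \<open>insert_point\<close>; each insertion
  multiplies the total mass by \<open>total\<close>.\<close>

primrec insert_points :: "'a measure measure \<Rightarrow> nat \<Rightarrow> 'a measure measure" where
  "insert_points M0 0 = M0"
| "insert_points M0 (Suc n) =
    distr (insert_points M0 n \<Otimes>\<^sub>M l) (counting_measure_space Y) (\<lambda>(\<nu>, x). add_measure \<nu> (return Y x))"

text \<open>A mixture over the number \<open>n\<close> of added points. The factor
  \<open>total ^ n\<close> of the Poisson weight sits in the mass of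
  \<open>insert_points M0 n\<close>, so \<open>exp (- total) / fact n\<close> remains.\<close>

definition superpose_poisson :: "'a measure measure \<Rightarrow> 'a measure measure" where
  "superpose_poisson M0 =
    sum_measure (counting_measure_space Y) (\<lambda>n. scale_measure (ennreal (exp (- total) / fact n)) (insert_points M0 n))"

lemma sets_insert_points:
  "sets M0 = sets (counting_measure_space Y) \<Longrightarrow> sets (insert_points M0 n) = sets (counting_measure_space Y)"
  by (cases n) auto

lemma measurable_add_point_insert_points:
  assumes "sets N = sets (counting_measure_space Y)"
  shows "(\<lambda>(\<nu>, x). add_measure \<nu> (return Y x)) \<in> measurable (N \<Otimes>\<^sub>M l) (counting_measure_space Y)"
  using measurable_add_point[of Y] measurable_cong_sets[OF sets_pair_measure_cong[OF assms sets_l] refl]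
  by blast

lemma finite_insert_points:
  assumes "finite_measure M0" "sets M0 = sets (counting_measure_space Y)"
  shows "finite_measure (insert_points M0 n)"
proof (induction n)
  case (Suc n)
  interpret N: finite_measure "insert_points M0 n" by fact
  interpret P: pair_sigma_finite "insert_points M0 n" l ..
  interpret pair: finite_measure "insert_points M0 n \<Otimes>\<^sub>M l"
    by (rule finite_measure_pair_measure) unfold_locales
  show ?case
    using measurable_add_point_insert_points[OF sets_insert_points[OF assms(2)]]
    by (simp add: pair.finite_measure_distr)
qed (use assms in simp)

lemma integrable_bounded_functional:
  assumes f: "bounded_functional Y C f" and N: "finite_measure N" "sets N = sets (counting_measure_space Y)"
  shows "integrable N f"
proof -
  interpret finite_measure N by fact
  have "space N = counting_measures Y" using sets_eq_imp_space_eq[OF N(2)] by simp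
  then show ?thesis
    using f N(2) by (intro integrable_const_bound[of _ C]) (auto simp: bounded_functional_def cong: measurable_cong_sets)
qed

text \<open>Fubini trades the point added last to the measure for one application of
  \<open>insert_point\<close> to the functional.\<close>

lemma integral_insert_points_Suc:
  assumes f: "bounded_functional Y C f" and M0: "finite_measure M0" "sets M0 = sets (counting_measure_space Y)"
  shows "(\<integral>\<nu>. f \<nu> \<partial>insert_points M0 (Suc n)) = (\<integral>\<nu>. insert_point f \<nu> \<partial>insert_points M0 n)"
proof -
  interpret N: finite_measure "insert_points M0 n" by (rule finite_insert_points[OF M0])
  interpret P: pair_sigma_finite "insert_points M0 n" l ..
  interpret pair: finite_measure "insert_points M0 n \<Otimes>\<^sub>M l"
    by (rule finite_measure_pair_measure) unfold_locales
  note meas = measurable_add_point_insert_points[OF sets_insert_points[OF M0(2)], of n]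
  have f': "f \<in> borel_measurable (counting_measure_space Y)" using f by (simp add: bounded_functional_def)
  have int: "integrable (insert_points M0 n \<Otimes>\<^sub>M l) (\<lambda>(\<nu>, x). f (add_measure \<nu> (return Y x)))"
  proof (rule pair.integrable_const_bound[of _ C])
    have "space (insert_points M0 n \<Otimes>\<^sub>M l) = counting_measures Y \<times> space Y"
      using sets_eq_imp_space_eq[OF sets_insert_points[OF M0(2)]] by (simp add: space_pair_measure)
    then show "AE w in insert_points M0 n \<Otimes>\<^sub>M l. norm (case w of (\<nu>, x) \<Rightarrow> f (add_measure \<nu> (return Y x))) \<le> C"
      using f by (auto simp: bounded_functional_def add_dirac_in_counting_measures)
    show "(\<lambda>(\<nu>, x). f (add_measure \<nu> (return Y x))) \<in> borel_measurable (insert_points M0 n \<Otimes>\<^sub>M l)"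
      using measurable_compose[OF meas f'] by (simp add: case_prod_beta')
  qed
  have "(\<integral>\<nu>. f \<nu> \<partial>insert_points M0 (Suc n)) =
      (\<integral>w. (case w of (\<nu>, x) \<Rightarrow> f (add_measure \<nu> (return Y x))) \<partial>(insert_points M0 n \<Otimes>\<^sub>M l))"
    unfolding insert_points.simps integral_distr[OF meas f'] by (simp add: case_prod_beta')
  also have "\<dots> = (\<integral>\<nu>. insert_point f \<nu> \<partial>insert_points M0 n)"
    unfolding insert_point_def using P.integral_fst[OF int] by simp
  finally show ?thesis .
qed

lemma integral_insert_points:
  assumes "bounded_functional Y C f" and M0: "finite_measure M0" "sets M0 = sets (counting_measure_space Y)"
  shows "(\<integral>\<nu>. f \<nu> \<partial>insert_points M0 n) = (\<integral>\<nu>. (insert_point ^^ n) f \<nu> \<partial>M0)"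
  using assms(1)
proof (induction n arbitrary: C f)
  case (Suc n)
  show ?case
    unfolding integral_insert_points_Suc[OF Suc.prems M0] Suc.IH[OF insert_point_bounded[OF Suc.prems]]
    by (simp add: funpow_swap1)
qed simp

lemma measure_insert_points_Suc:
  assumes M0: "finite_measure M0" "sets M0 = sets (counting_measure_space Y)"
    and A: "A \<in> sets (counting_measure_space Y)"
  shows "measure (insert_points M0 (Suc n)) A = (\<integral>\<nu>. insert_point (indicator A) \<nu> \<partial>insert_points M0 n)"
proof -
  have "measure (insert_points M0 (Suc n)) A = (\<integral>\<nu>. indicator A \<nu> \<partial>insert_points M0 (Suc n))"
    using A sets.sets_into_space[OF A] by (simp del: space_counting_measure_space add: Int_absorb2)
  then show ?thesis
    by (simp only: integral_insert_points_Suc[OF bounded_functional_indicator[OF A] M0])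
qed

text \<open>Nonnegativity allows the mixture to be integrated term by term in
  \<open>ennreal\<close>, before anything is known about integrability under it. Under
  \<open>M0\<close>, sum and integral are exchanged by means of the summable bound
  \<open>C * total ^ n / fact n\<close>.\<close>

lemma integral_superpose_poisson:
  assumes f: "bounded_functional Y C f" and nonneg: "\<And>\<nu>. \<nu> \<in> counting_measures Y \<Longrightarrow> 0 \<le> f \<nu>"
    and M0: "finite_measure M0" "sets M0 = sets (counting_measure_space Y)"
  shows "integrable M0 (add_poisson f)"
    and "(\<integral>\<nu>. f \<nu> \<partial>superpose_poisson M0) = (\<integral>\<nu>. add_poisson f \<nu> \<partial>M0)"
proof -
  interpret M0: finite_measure M0 by fact
  let ?w = "\<lambda>n. exp (- total) / fact n" and ?T = "\<lambda>n. (insert_point ^^ n) f"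
  have space: "space N = counting_measures Y" if "sets N = sets (counting_measure_space Y)" for N
    using sets_eq_imp_space_eq[OF that] by simp
  have T: "integrable M0 (?T n)" for n
    by (rule integrable_bounded_functional[OF funpow_insert_point_bounded[OF f] M0])
  have bd: "\<bar>?w n * ?T n \<nu>\<bar> \<le> ?w n * (C * total ^ n)" if "\<nu> \<in> space M0" for n \<nu>
    using funpow_insert_point_bounded[OF f, of n] that space[OF M0(2)]
    by (auto simp: bounded_functional_def abs_mult intro!: divide_right_mono)
  have sm: "summable (\<lambda>n. ?w n * (C * total ^ n))"
    using summable_mult[OF summable_exp[of total], of "exp (- total) * C"] by (simp add: field_simps)
  have sm1: "summable (\<lambda>n. \<bar>?w n * ?T n \<nu>\<bar>)" if "\<nu> \<in> space M0" for \<nu>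
    using bd[OF that] by (intro summable_comparison_test[OF _ sm]) auto
  have sm2: "summable (\<lambda>n. \<integral>\<nu>. \<bar>?w n * ?T n \<nu>\<bar> \<partial>M0)"
  proof (rule summable_comparison_test)
    show "\<exists>N. \<forall>n\<ge>N. norm (\<integral>\<nu>. \<bar>?w n * ?T n \<nu>\<bar> \<partial>M0) \<le> measure M0 (space M0) * (?w n * (C * total ^ n))"
    proof (intro exI allI impI)
      fix n
      have "norm (\<integral>\<nu>. \<bar>?w n * ?T n \<nu>\<bar> \<partial>M0) = (\<integral>\<nu>. \<bar>?w n * ?T n \<nu>\<bar> \<partial>M0)"
        unfolding real_norm_def by (intro abs_of_nonneg integral_nonneg_AE) auto
      also have "\<dots> \<le> (\<integral>\<nu>. ?w n * (C * total ^ n) \<partial>M0)"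
        using T bd by (intro integral_mono) auto
      also have "\<dots> = measure M0 (space M0) * (?w n * (C * total ^ n))"
        by (simp only: lebesgue_integral_const real_scaleR_def)
      finally show "norm (\<integral>\<nu>. \<bar>?w n * ?T n \<nu>\<bar> \<partial>M0) \<le> measure M0 (space M0) * (?w n * (C * total ^ n))" .
    qed
    show "summable (\<lambda>n. measure M0 (space M0) * (?w n * (C * total ^ n)))"
      by (rule summable_mult[OF sm])
  qed
  have ap: "add_poisson f \<nu> = (\<Sum>n. ?w n * ?T n \<nu>)" if "\<nu> \<in> space M0" for \<nu>
  proof -
    have "summable (\<lambda>n. ?w n * ?T n \<nu>)" using sm1[OF that] by (rule summable_rabs_cancel)
    then have "summable (\<lambda>n. exp (- total) * (?T n \<nu> / fact n))" by simp
    then have "summable (\<lambda>n. ?T n \<nu> / fact n)" by (rule summable_mult_D) simp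
    from suminf_mult[OF this, of "exp (- total)"] show ?thesis by (simp add: add_poisson_def)
  qed
  have "integrable M0 (\<lambda>\<nu>. \<Sum>n. ?w n * ?T n \<nu>)"
    using T sm1 sm2 by (intro integrable_suminf) auto
  then show "integrable M0 (add_poisson f)"
    using ap by (subst Bochner_Integration.integrable_cong[OF refl]) auto
  have Sum: "(\<integral>\<nu>. add_poisson f \<nu> \<partial>M0) = (\<Sum>n. ?w n * (\<integral>\<nu>. ?T n \<nu> \<partial>M0))"
  proof -
    have "(\<integral>\<nu>. add_poisson f \<nu> \<partial>M0) = (\<integral>\<nu>. (\<Sum>n. ?w n * ?T n \<nu>) \<partial>M0)"
      using ap by (intro Bochner_Integration.integral_cong) auto
    also have "\<dots> = (\<Sum>n. \<integral>\<nu>. ?w n * ?T n \<nu> \<partial>M0)"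
      using T sm1 sm2 by (intro integral_suminf) auto
    finally show ?thesis by simp
  qed
  have int_n: "integrable (insert_points M0 n) f" for n
    by (rule integrable_bounded_functional[OF f finite_insert_points[OF M0] sets_insert_points[OF M0(2)]])
  have nn_n: "0 \<le> (\<integral>\<nu>. ?T n \<nu> \<partial>M0)" for n
    unfolding integral_insert_points[OF f M0, symmetric]
    using nonneg space[OF sets_insert_points[OF M0(2)]] by (intro integral_nonneg_AE) auto
  have sm3: "summable (\<lambda>n. ?w n * (\<integral>\<nu>. ?T n \<nu> \<partial>M0))"
  proof (rule summable_comparison_test[OF _ sm2], intro exI allI impI)
    fix n
    have "norm (\<integral>\<nu>. ?w n * ?T n \<nu> \<partial>M0) \<le> (\<integral>\<nu>. norm (?w n * ?T n \<nu>) \<partial>M0)"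
      by (rule integral_norm_bound)
    then show "norm (?w n * (\<integral>\<nu>. ?T n \<nu> \<partial>M0)) \<le> (\<integral>\<nu>. \<bar>?w n * ?T n \<nu>\<bar> \<partial>M0)" by simp
  qed
  have f': "f \<in> borel_measurable (insert_points M0 n)" for n
    using f sets_insert_points[OF M0(2), of n] by (auto simp: bounded_functional_def cong: measurable_cong_sets)
  have sets_sp: "sets (superpose_poisson M0) = sets (counting_measure_space Y)" by (simp add: superpose_poisson_def)
  have "(\<integral>\<^sup>+\<nu>. ennreal (f \<nu>) \<partial>superpose_poisson M0) =
      (\<Sum>n. \<integral>\<^sup>+\<nu>. ennreal (f \<nu>) \<partial>scale_measure (ennreal (?w n)) (insert_points M0 n))"
    unfolding superpose_poisson_def
    using f by (intro nn_integral_sum_measure) (auto simp: bounded_functional_def sets_insert_points[OF M0(2)])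
  also have "\<dots> = (\<Sum>n. ennreal (?w n) * ennreal (\<integral>\<nu>. f \<nu> \<partial>insert_points M0 n))"
  proof (intro suminf_cong)
    fix n
    have "(\<integral>\<^sup>+\<nu>. ennreal (f \<nu>) \<partial>insert_points M0 n) = ennreal (\<integral>\<nu>. f \<nu> \<partial>insert_points M0 n)"
      using nonneg space[OF sets_insert_points[OF M0(2)]]
      by (intro nn_integral_eq_integral int_n) auto
    then show "(\<integral>\<^sup>+\<nu>. ennreal (f \<nu>) \<partial>scale_measure (ennreal (?w n)) (insert_points M0 n)) =
      ennreal (?w n) * ennreal (\<integral>\<nu>. f \<nu> \<partial>insert_points M0 n)"
      using f'[of n] by (subst nn_integral_scale_measure) auto
  qed
  also have "\<dots> = (\<Sum>n. ennreal (?w n * (\<integral>\<nu>. ?T n \<nu> \<partial>M0)))"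
    unfolding integral_insert_points[OF f M0] using nn_n by (intro suminf_cong ennreal_mult[symmetric]) auto
  also have "\<dots> = ennreal (\<Sum>n. ?w n * (\<integral>\<nu>. ?T n \<nu> \<partial>M0))"
    using nn_n by (intro suminf_ennreal2 sm3) auto
  finally have nn: "(\<integral>\<^sup>+\<nu>. ennreal (f \<nu>) \<partial>superpose_poisson M0) = ennreal (\<integral>\<nu>. add_poisson f \<nu> \<partial>M0)"
    unfolding Sum .
  have "(\<integral>\<nu>. f \<nu> \<partial>superpose_poisson M0) = enn2real (\<integral>\<^sup>+\<nu>. ennreal (f \<nu>) \<partial>superpose_poisson M0)"
    using f nonneg space[OF sets_sp]
    by (intro integral_eq_nn_integral) (auto simp: sets_sp bounded_functional_def cong: measurable_cong_sets)
  also have "\<dots> = (\<integral>\<nu>. add_poisson f \<nu> \<partial>M0)"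
    unfolding nn Sum using nn_n by (intro enn2real_ennreal suminf_nonneg sm3) auto
  finally show "(\<integral>\<nu>. f \<nu> \<partial>superpose_poisson M0) = (\<integral>\<nu>. add_poisson f \<nu> \<partial>M0)" .
qed

end

section \<open>Cell counts after inserting points into a set\<close>

locale finite_intensity_on = finite_intensity l Y for l Y :: "'a measure" +
  fixes Z :: "'a set"
  assumes Z [measurable]: "Z \<in> sets Y" and AE_Z: "AE x in l. x \<in> Z"
begin

text \<open>Inside \<open>Z\<close> the counts are natural numbers, so that one of them can be
  lowered when an inserted point is removed; outside \<open>Z\<close> the prescribed count may be
  infinite.\<close>

definition occupancy :: "'a set set \<Rightarrow> ('a set \<Rightarrow> ennreal) \<Rightarrow> ('a set \<Rightarrow> nat) \<Rightarrow> 'a measure set" where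
  "occupancy R c k = cell Y R (\<lambda>A. if A \<subseteq> Z then of_nat (k A) else c A)"

text \<open>Only the cell containing \<open>x\<close> contributes, and before the insertion it held
  one point less. The case \<open>k A = 0\<close> is separated because truncated subtraction would
  leave the count at zero, whereas a cell that has just received a point is not empty.\<close>

lemma indicator_occupancy_add_point:
  assumes R: "fine_partition Y Z R" and \<nu>: "\<nu> \<in> counting_measures Y" and x: "x \<in> Z"
  shows "indicator (occupancy R c k) (add_measure \<nu> (return Y x)) =
    (\<Sum>A | A \<in> R \<and> A \<subseteq> Z. indicator A x *
       (if k A = 0 then 0 else indicator (occupancy R c (k(A := k A - 1))) \<nu> :: real))"
proof -
  have fin: "finite R" and sub: "R \<subseteq> sets Y" and disj: "disjoint R" and un: "\<Union>R = space Y"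
    and fine: "\<And>A. A \<in> R \<Longrightarrow> A \<subseteq> Z \<or> A \<inter> Z = {}"
    using R by (auto simp: fine_partition_def)
  have xY: "x \<in> space Y" using x Z sets.sets_into_space by blast
  then obtain A0 where A0: "A0 \<in> R" "x \<in> A0" using un by blast
  then have A0Z: "A0 \<subseteq> Z" using fine x by blast
  have ne: "x \<notin> A" if "A \<in> R" "A \<noteq> A0" for A
    using disj that A0 unfolding disjoint_def by blast
  have "(\<Sum>A | A \<in> R \<and> A \<subseteq> Z. indicator A x *
       (if k A = 0 then 0 else indicator (occupancy R c (k(A := k A - 1))) \<nu> :: real)) =
      (\<Sum>A\<in>{A0}. indicator A x *
       (if k A = 0 then 0 else indicator (occupancy R c (k(A := k A - 1))) \<nu> :: real))"
    using fin A0 A0Z ne by (intro sum.mono_neutral_right) auto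
  also have "\<dots> = (if k A0 = 0 then 0 else indicator (occupancy R c (k(A0 := k A0 - 1))) \<nu>)"
    by (subst sum.insert) (use A0 in auto)
  also have "\<dots> = indicator (occupancy R c k) (add_measure \<nu> (return Y x))"
  proof -
    have em: "emeasure (add_measure \<nu> (return Y x)) A = emeasure \<nu> A + (if A = A0 then 1 else 0)" if "A \<in> R" for A
      using emeasure_add_point[OF \<nu>, of A x] that sub A0 ne by (cases "A = A0") (auto simp: indicator_def)
    have cm: "add_measure \<nu> (return Y x) \<in> counting_measures Y"
      by (rule add_dirac_in_counting_measures[OF \<nu> xY])
    show ?thesis
    proof (cases "k A0")
      case 0
      have "add_measure \<nu> (return Y x) \<notin> occupancy R c k"
      proof
        assume "add_measure \<nu> (return Y x) \<in> occupancy R c k"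
        then have "emeasure (add_measure \<nu> (return Y x)) A0 = 0"
          using A0(1) A0Z 0 by (auto simp: occupancy_def cell_def)
        then show False using em[OF A0(1)] by simp
      qed
      then show ?thesis using 0 by simp
    next
      case (Suc j)
      have "emeasure \<nu> A0 + 1 = of_nat (Suc j) \<longleftrightarrow> emeasure \<nu> A0 = of_nat j"
        using ennreal_add_left_cancel[of 1 "emeasure \<nu> A0" "of_nat j"] by (simp add: add.commute)
      then have "add_measure \<nu> (return Y x) \<in> occupancy R c k \<longleftrightarrow> \<nu> \<in> occupancy R c (k(A0 := k A0 - 1))"
        using em cm \<nu> A0 A0Z Suc unfolding occupancy_def cell_def by force
      then show ?thesis using Suc by (simp add: indicator_def)
    qed
  qed
  finally show ?thesis ..
qed

lemma insert_point_occupancy: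
  assumes R: "fine_partition Y Z R" and \<nu>: "\<nu> \<in> counting_measures Y"
  shows "insert_point (indicator (occupancy R c k)) \<nu> =
    (\<Sum>A | A \<in> R \<and> A \<subseteq> Z. measure l A *
       (if k A = 0 then 0 else indicator (occupancy R c (k(A := k A - 1))) \<nu>))"
proof -
  have fin: "finite R" and sub: "R \<subseteq> sets Y" using R by (auto simp: fine_partition_def)
  let ?g = "\<lambda>x. \<Sum>A | A \<in> R \<and> A \<subseteq> Z. indicator A x *
       (if k A = 0 then 0 else indicator (occupancy R c (k(A := k A - 1))) \<nu> :: real)"
  have occ: "occupancy R c k \<in> sets (counting_measure_space Y)"
    unfolding occupancy_def using fin sub by (rule cell_measurable)
  have "insert_point (indicator (occupancy R c k)) \<nu> = (\<integral>x. ?g x \<partial>l)"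
    unfolding insert_point_def
  proof (rule integral_cong_AE)
    show "(\<lambda>x. indicator (occupancy R c k) (add_measure \<nu> (return Y x)) :: real) \<in> borel_measurable l"
      using integrable_add_point[OF bounded_functional_indicator[OF occ] \<nu>] by (rule borel_measurable_integrable)
    show "?g \<in> borel_measurable l"
      using sub by (intro borel_measurable_sum borel_measurable_times borel_measurable_indicator) auto
    show "AE x in l. indicator (occupancy R c k) (add_measure \<nu> (return Y x)) = ?g x"
      using AE_Z indicator_occupancy_add_point[OF R \<nu>] by (auto elim!: eventually_mono)
  qed
  also have "\<dots> = (\<Sum>A | A \<in> R \<and> A \<subseteq> Z. \<integral>x. indicator A x *
       (if k A = 0 then 0 else indicator (occupancy R c (k(A := k A - 1))) \<nu>) \<partial>l)"
    using sub by (intro Bochner_Integration.integral_sum integrable_mult_left)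
      (auto intro!: integrable_real_indicator simp: emeasure_eq_measure)
  also have "\<dots> = (\<Sum>A | A \<in> R \<and> A \<subseteq> Z. measure l A *
       (if k A = 0 then 0 else indicator (occupancy R c (k(A := k A - 1))) \<nu>))"
    using sub sets.sets_into_space by (intro sum.cong) (auto simp: Int_absorb2 subset_eq)
  finally show ?thesis .
qed

text \<open>A multinomial law: \<open>fact n\<close> divided by the factorials of the counts is the
  number of ways to distribute \<open>n\<close> labelled points, while the counts outside
  \<open>Z\<close> keep their law under \<open>M0\<close>. In the induction the last point falls
  into some cell \<open>A\<close>; its contribution is proportional to \<open>k A\<close>, and these
  numbers sum to \<open>Suc n\<close>.\<close>

lemma measure_insert_points_occupancy:
  assumes M0: "finite_measure M0" "sets M0 = sets (counting_measure_space Y)"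
    and M0_Z: "AE \<nu> in M0. emeasure \<nu> Z = 0"
    and R: "fine_partition Y Z R"
  shows "measure (insert_points M0 n) (occupancy R c k) =
    (if (\<Sum>A | A \<in> R \<and> A \<subseteq> Z. k A) = n
     then measure M0 (cell Y {A\<in>R. \<not> A \<subseteq> Z} c) *
       (fact n * (\<Prod>A | A \<in> R \<and> A \<subseteq> Z. measure l A ^ k A / fact (k A)))
     else 0)"
proof (induction n arbitrary: k)
  interpret M0: finite_measure M0 by fact
  have fin: "finite R" and sub: "R \<subseteq> sets Y" using R by (auto simp: fine_partition_def)
  let ?RZ = "{A. A \<in> R \<and> A \<subseteq> Z}"
  have finZ: "finite ?RZ" using fin by simp
  have occ: "occupancy R c k \<in> sets (counting_measure_space Y)" for k
    unfolding occupancy_def using fin sub by (rule cell_measurable)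
  {
    case 0
    have cl: "cell Y {A\<in>R. \<not> A \<subseteq> Z} c \<in> sets M0"
      unfolding M0(2) using fin sub by (intro cell_measurable) auto
    \<comment> \<open>\<open>M0\<close> has no points in \<open>Z\<close>, so before any insertion
      only the zero profile inside \<open>Z\<close> carries mass.\<close>
    have 1: "AE \<nu> in M0. \<nu> \<in> occupancy R c k \<longleftrightarrow> (\<forall>A\<in>?RZ. k A = 0) \<and> \<nu> \<in> cell Y {A\<in>R. \<not> A \<subseteq> Z} c"
      using M0_Z AE_space
    proof eventually_elim
      case (elim \<nu>)
      then have \<nu>: "\<nu> \<in> counting_measures Y" using sets_eq_imp_space_eq[OF M0(2)] by simp
      have "emeasure \<nu> A = 0" if "A \<in> ?RZ" for A
      proof -
        have "emeasure \<nu> A \<le> emeasure \<nu> Z"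
          using that Z sub counting_measures_sets[OF \<nu>] by (intro emeasure_mono) auto
        then show ?thesis using elim by simp
      qed
      then show ?case using \<nu> by (auto simp: occupancy_def cell_def)
    qed
    show ?case
    proof (cases "\<forall>A\<in>?RZ. k A = 0")
      case True
      then have "measure M0 (occupancy R c k) = measure M0 (cell Y {A\<in>R. \<not> A \<subseteq> Z} c)"
        using 1 occ cl M0(2) by (intro measure_eq_AE) auto
      moreover have "(\<Prod>A\<in>?RZ. measure l A ^ k A / fact (k A)) = 1"
        using True by (intro prod.neutral) auto
      ultimately show ?thesis using True by simp
    next
      case False
      then have "measure M0 (occupancy R c k) = measure M0 {}"
        using 1 occ cl M0(2) by (intro measure_eq_AE) auto
      moreover have "(\<Sum>A\<in>?RZ. k A) \<noteq> 0" using False finZ by auto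
      ultimately show ?thesis by simp
    qed
  next
    case (Suc n)
    let ?p = "measure M0 (cell Y {A\<in>R. \<not> A \<subseteq> Z} c)"
    let ?W = "\<lambda>k. \<Prod>A\<in>?RZ. measure l A ^ k A / fact (k A)"
    let ?d = "\<lambda>A. k(A := k A - 1)"
    note N = finite_insert_points[OF M0, of n] sets_insert_points[OF M0(2), of n]
    interpret N: finite_measure "insert_points M0 n" by (rule N)
    have N_space: "space (insert_points M0 n) = counting_measures Y"
      using sets_eq_imp_space_eq[OF N(2)] by simp
    have occN: "occupancy R c k \<in> sets (insert_points M0 n)" for k using occ N(2) by simp
    have "measure (insert_points M0 (Suc n)) (occupancy R c k) =
        (\<integral>\<nu>. (\<Sum>A\<in>?RZ. measure l A * (if k A = 0 then 0 else indicator (occupancy R c (?d A)) \<nu>)) \<partial>insert_points M0 n)"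
      unfolding measure_insert_points_Suc[OF M0 occ]
      by (intro Bochner_Integration.integral_cong refl insert_point_occupancy[OF R]) (simp add: N_space)
    also have "\<dots> = (\<Sum>A\<in>?RZ. \<integral>\<nu>. measure l A * (if k A = 0 then 0 else indicator (occupancy R c (?d A)) \<nu>) \<partial>insert_points M0 n)"
    proof (rule Bochner_Integration.integral_sum)
      show "integrable (insert_points M0 n) (\<lambda>\<nu>. measure l A * (if k A = 0 then 0 else indicator (occupancy R c (?d A)) \<nu>))" for A
        using occN by (cases "k A = 0") (auto intro!: integrable_mult_right simp: N.emeasure_eq_measure)
    qed
    also have "\<dots> = (\<Sum>A\<in>?RZ. measure l A * (if k A = 0 then 0 else measure (insert_points M0 n) (occupancy R c (?d A))))"
      using sets.sets_into_space[OF occN] by (intro sum.cong) (auto simp: Int_absorb2)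
    also have "\<dots> = (\<Sum>A\<in>?RZ. if (\<Sum>A\<in>?RZ. k A) = Suc n then ?p * (fact n * (real (k A) * ?W k)) else 0)"
    proof (intro sum.cong refl)
      fix A assume A: "A \<in> ?RZ"
      show "measure l A * (if k A = 0 then 0 else measure (insert_points M0 n) (occupancy R c (?d A))) =
        (if (\<Sum>A\<in>?RZ. k A) = Suc n then ?p * (fact n * (real (k A) * ?W k)) else 0)"
      proof (cases "k A")
        case (Suc j)
        have "(\<Sum>A\<in>?RZ. k A) = k A + (\<Sum>A\<in>?RZ - {A}. k A)"
          using A finZ by (rule sum.remove[rotated])
        moreover have "(\<Sum>B\<in>?RZ. ?d A B) = ?d A A + (\<Sum>B\<in>?RZ - {A}. ?d A B)"
          using A finZ by (rule sum.remove[rotated])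
        moreover have "(\<Sum>B\<in>?RZ - {A}. ?d A B) = (\<Sum>B\<in>?RZ - {A}. k B)"
          by (intro sum.cong) auto
        ultimately have s: "(\<Sum>B\<in>?RZ. ?d A B) = n \<longleftrightarrow> (\<Sum>A\<in>?RZ. k A) = Suc n"
          using Suc by simp
        define Q where "Q = (\<Prod>B\<in>?RZ - {A}. measure l B ^ k B / fact (k B))"
        have e1: "?W k = measure l A ^ Suc j / fact (Suc j) * Q"
          using prod.remove[OF finZ A, of "\<lambda>B. measure l B ^ k B / fact (k B)"] Suc by (simp add: Q_def)
        have "(\<Prod>B\<in>?RZ - {A}. measure l B ^ ?d A B / fact (?d A B)) = Q"
          unfolding Q_def by (intro prod.cong) auto
        then have e2: "?W (?d A) = measure l A ^ j / fact j * Q"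
          using prod.remove[OF finZ A, of "\<lambda>B. measure l B ^ ?d A B / fact (?d A B)"] Suc by simp
        \<comment> \<open>Restoring the removed point trades a factor \<open>measure l A\<close> for
          \<open>k A\<close>, the ratio of the two factorials.\<close>
        have w: "measure l A * ?W (?d A) = real (k A) * ?W k"
          unfolding e1 e2 unfolding Suc fact_Suc power_Suc by (simp del: of_nat_Suc)
        have "measure l A * measure (insert_points M0 n) (occupancy R c (?d A)) =
            (if (\<Sum>A\<in>?RZ. k A) = Suc n then ?p * (fact n * (measure l A * ?W (?d A))) else 0)"
          unfolding Suc.IH s by simp
        then show ?thesis unfolding w using Suc by simp
      qed simp
    qed
    also have "\<dots> = (if (\<Sum>A\<in>?RZ. k A) = Suc n then ?p * (fact n * (real (\<Sum>A\<in>?RZ. k A) * ?W k)) else 0)"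
    proof -
      have "(\<Sum>A\<in>?RZ. ?p * (fact n * (real (k A) * ?W k))) = ?p * (fact n * (real (\<Sum>A\<in>?RZ. k A) * ?W k))"
        by (simp only: of_nat_sum sum_distrib_left[symmetric] sum_distrib_right[symmetric])
      then show ?thesis by (cases "(\<Sum>A\<in>?RZ. k A) = Suc n") (simp_all only: simp_thms if_True if_False sum.neutral_const)
    qed
    also have "\<dots> = (if (\<Sum>A\<in>?RZ. k A) = Suc n then ?p * (fact (Suc n) * ?W k) else 0)"
      by (simp add: mult_ac)
    finally show ?case .
  }
qed

text \<open>One more point neither creates nor destroys an infinite count, so each insertion
  multiplies the mass of this event, initially zero, by \<open>total\<close>.\<close>

lemma measure_insert_points_infinite:
  assumes M0: "finite_measure M0" "sets M0 = sets (counting_measure_space Y)"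
    and M0_Z: "AE \<nu> in M0. emeasure \<nu> Z = 0"
  shows "measure (insert_points M0 n) {\<nu>\<in>counting_measures Y. emeasure \<nu> Z = \<infinity>} = 0"
proof (induction n)
  let ?I = "{\<nu>\<in>counting_measures Y. emeasure \<nu> Z = \<infinity>}"
  have "{\<nu>\<in>space (counting_measure_space Y). emeasure \<nu> Z = \<infinity>} \<in> sets (counting_measure_space Y)"
    by measurable
  then have I: "?I \<in> sets (counting_measure_space Y)" by simp
  {
    case 0
    interpret M0: finite_measure M0 by fact
    have "measure M0 ?I = measure M0 {}"
      using M0_Z I M0(2) by (intro measure_eq_AE) auto
    then show ?case by simp
  next
    case (Suc n)
    have N_space: "space (insert_points M0 n) = counting_measures Y"
      using sets_eq_imp_space_eq[OF sets_insert_points[OF M0(2)]] by simp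
    have "insert_point (indicator ?I) \<nu> = total * indicator ?I \<nu>" if \<nu>: "\<nu> \<in> counting_measures Y" for \<nu>
    proof -
      have "indicator ?I (add_measure \<nu> (return Y x)) = (indicator ?I \<nu> :: real)" if "x \<in> space Y" for x
        using \<nu> that by (auto simp: indicator_def emeasure_add_point add_dirac_in_counting_measures)
      then have "insert_point (indicator ?I) \<nu> = (\<integral>x. indicator ?I \<nu> \<partial>l)"
        unfolding insert_point_def by (intro Bochner_Integration.integral_cong) auto
      then show ?thesis by simp
    qed
    then have "measure (insert_points M0 (Suc n)) ?I = (\<integral>\<nu>. total * indicator ?I \<nu> \<partial>insert_points M0 n)"
      unfolding measure_insert_points_Suc[OF M0 I] by (intro Bochner_Integration.integral_cong) (auto simp: N_space)
    also have "\<dots> = total * measure (insert_points M0 n) (?I \<inter> space (insert_points M0 n))"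
      by simp
    also have "?I \<inter> space (insert_points M0 n) = ?I" by (auto simp: N_space)
    finally show ?case using Suc by simp
  }
qed

end

section \<open>The law of a Poisson process\<close>

locale poisson_law = prob_space M for M :: "'w measure" +
  fixes Y lam :: "'a measure" and \<eta> :: "'w \<Rightarrow> 'a measure"
  assumes sets_lam [simp, measurable_cong]: "sets lam = sets Y" and pp: "poisson_process M Y lam \<eta>"
begin

definition law :: "'a measure measure" where
  "law = distr M (counting_measure_space Y) \<eta>"

lemma space_lam [simp]: "space lam = space Y"
  by (rule sets_eq_imp_space_eq) simp

lemma eta_measurable [measurable]: "\<eta> \<in> measurable M (counting_measure_space Y)"
  using pp by (simp add: poisson_process_def)

lemma sets_law [simp, measurable_cong]: "sets law = sets (counting_measure_space Y)"
  by (simp add: law_def)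

lemma space_law [simp]: "space law = counting_measures Y"
  by (simp add: law_def)

lemma prob_space_law: "prob_space law"
  unfolding law_def by (rule prob_space_distr) measurable

lemma eta_space: "\<omega> \<in> space M \<Longrightarrow> \<eta> \<omega> \<in> counting_measures Y"
  using measurable_space[OF eta_measurable] by simp

lemma law_cell:
  assumes "finite S" "S \<subseteq> sets Y"
  shows "measure law (cell Y S c) = prob {\<omega>\<in>space M. \<forall>A\<in>S. emeasure (\<eta> \<omega>) A = c A}"
proof -
  have "\<eta> -` cell Y S c \<inter> space M = {\<omega>\<in>space M. \<forall>A\<in>S. emeasure (\<eta> \<omega>) A = c A}"
    using eta_space by (auto simp: cell_def)
  then show ?thesis
    unfolding law_def using cell_measurable[OF assms] by (simp add: measure_distr)
qed

text \<open>Independence is available for families indexed by \<open>{..<k}\<close>, hence the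
  enumeration of \<open>S\<close>. Empty \<open>S\<close> is treated apart, since an intersection
  over no indices is the universe rather than \<open>space M\<close>.\<close>

lemma law_cell_prod:
  assumes S: "finite S" "S \<subseteq> sets Y" "disjoint S"
  shows "measure law (cell Y S c) = (\<Prod>A\<in>S. measure law (cell Y {A} c))"
proof (cases "S = {}")
  case True
  have "cell Y {} c = space law" by (simp add: cell_def)
  then show ?thesis using True prob_space.prob_space[OF prob_space_law] by simp
next
  case False
  obtain b where b: "bij_betw b {..<card S} S"
    using ex_bij_betw_nat_finite[OF S(1)] by (auto simp: atLeast0LessThan)
  have im: "b ` {..<card S} = S" and inj: "inj_on b {..<card S}"
    using b by (auto simp: bij_betw_def)
  have ne: "{..<card S} \<noteq> {}" using im False by auto
  have "disjoint_family_on b {..<card S}"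
    unfolding disjoint_family_on_def
  proof (intro ballI impI)
    fix i j assume "i \<in> {..<card S}" "j \<in> {..<card S}" "i \<noteq> j"
    then have "b i \<in> S" "b j \<in> S" "b i \<noteq> b j" using im inj by (auto simp: inj_on_def)
    then show "b i \<inter> b j = {}" using S(3) by (auto simp: disjoint_def)
  qed
  then have ind: "indep_vars (\<lambda>_. borel) (\<lambda>i \<omega>. emeasure (\<eta> \<omega>) (b i)) {..<card S}"
    using pp S(2) im unfolding poisson_process_def by blast
  have "prob (\<Inter>i\<in>{..<card S}. (\<lambda>\<omega>. emeasure (\<eta> \<omega>) (b i)) -` {c (b i)} \<inter> space M) =
      (\<Prod>i<card S. prob ((\<lambda>\<omega>. emeasure (\<eta> \<omega>) (b i)) -` {c (b i)} \<inter> space M))"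
    by (intro indep_varsD_finite[OF ind] ne) auto
  also have "(\<Inter>i\<in>{..<card S}. (\<lambda>\<omega>. emeasure (\<eta> \<omega>) (b i)) -` {c (b i)} \<inter> space M) =
      {\<omega>\<in>space M. \<forall>A\<in>b ` {..<card S}. emeasure (\<eta> \<omega>) A = c A}"
    using ne by auto
  also have "(\<Prod>i<card S. prob ((\<lambda>\<omega>. emeasure (\<eta> \<omega>) (b i)) -` {c (b i)} \<inter> space M)) =
      (\<Prod>i<card S. measure law (cell Y {b i} c))"
  proof (intro prod.cong refl)
    fix i assume "i \<in> {..<card S}"
    then have "b i \<in> sets Y" using im S(2) by blast
    then show "prob ((\<lambda>\<omega>. emeasure (\<eta> \<omega>) (b i)) -` {c (b i)} \<inter> space M) = measure law (cell Y {b i} c)"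
      by (subst law_cell) (auto intro!: arg_cong[where f = prob])
  qed
  also have "\<dots> = (\<Prod>A\<in>S. measure law (cell Y {A} c))"
    by (rule prod.reindex_bij_betw[OF b])
  finally show ?thesis unfolding im law_cell[OF S(1,2)] .
qed

lemma law_finite_value:
  assumes A: "A \<in> sets Y" "emeasure lam A \<noteq> \<infinity>" and c: "c A = of_nat k"
  shows "measure law (cell Y {A} c) = measure lam A ^ k / fact k * exp (- measure lam A)"
proof -
  have "poisson_distributed M (\<lambda>\<omega>. emeasure (\<eta> \<omega>) A) (emeasure lam A)"
    using pp A by (auto simp: poisson_process_def)
  then have "prob {\<omega>\<in>space M. emeasure (\<eta> \<omega>) A = of_nat k} = measure lam A ^ k / fact k * exp (- measure lam A)"
    using A(2) by (simp add: poisson_distributed_def measure_def)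
  then show ?thesis using A c by (subst law_cell) auto
qed

text \<open>For finite parameter the Poisson condition prescribes only the masses at natural
  numbers. By the exponential series they sum to one, which leaves nothing for an infinite
  count.\<close>

lemma law_infinite_value:
  assumes A: "A \<in> sets Y" "emeasure lam A \<noteq> \<infinity>" and c: "c A = \<infinity>"
  shows "measure law (cell Y {A} c) = 0"
proof -
  interpret law: prob_space law by (rule prob_space_law)
  define D where "D k = cell Y {A} (\<lambda>_. of_nat k)" for k :: nat
  have D: "D k \<in> law.events" for k unfolding D_def using A by (simp add: cell_measurable)
  have "(\<lambda>k. measure lam A ^ k / fact k * exp (- measure lam A)) sums (exp (measure lam A) * exp (- measure lam A))"
    using sums_mult2[OF exp_converges[of "measure lam A"], of "exp (- measure lam A)"]
    by (simp add: field_simps)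
  then have 1: "(\<lambda>k. law.prob (D k)) sums 1"
    using law_finite_value[OF A] by (simp add: D_def exp_minus_inverse)
  have "disjoint_family D" by (auto simp: disjoint_family_on_def D_def cell_def)
  then have "(\<lambda>k. law.prob (D k)) sums law.prob (\<Union>k. D k)"
    using D by (intro law.finite_measure_UNION) auto
  then have "law.prob (\<Union>k. D k) = 1" using 1 sums_unique2 by blast
  then have "law.prob (space law - (\<Union>k. D k)) = 0" using D by (subst law.prob_compl) auto
  moreover have "cell Y {A} c \<subseteq> space law - (\<Union>k. D k)" using c by (auto simp: cell_def D_def)
  moreover have "space law - (\<Union>k. D k) \<in> law.events" using D by (intro sets.Diff sets.top sets.countable_UN) auto
  ultimately show ?thesis
    using law.finite_measure_mono[of "cell Y {A} c" "space law - (\<Union>k. D k)"] measure_nonneg[of law "cell Y {A} c"]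
    by linarith
qed

section \<open>Splitting the law at a set of finite intensity\<close>

text \<open>Restriction by a density keeps the result a counting measure on all of \<open>Y\<close>,
  to which points of \<open>Z\<close> can be added back.\<close>

definition outside :: "'a set \<Rightarrow> 'a measure measure" where
  "outside Z = distr law (counting_measure_space Y) (\<lambda>\<nu>. density \<nu> (indicator (space Y - Z)))"

lemma restrict_measurable_law [measurable]:
  "C \<in> sets Y \<Longrightarrow> (\<lambda>\<nu>. density \<nu> (indicator C)) \<in> measurable law (counting_measure_space Y)"
  unfolding measurable_cong_sets[OF sets_law refl] by (rule measurable_restrict_counting)

lemma sets_outside [simp, measurable_cong]: "sets (outside Z) = sets (counting_measure_space Y)"
  by (simp add: outside_def)

lemma prob_space_outside: "Z \<in> sets Y \<Longrightarrow> prob_space (outside Z)"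
  unfolding outside_def by (intro prob_space.prob_space_distr[OF prob_space_law] restrict_measurable_law) auto

lemma AE_outside:
  assumes [measurable]: "Z \<in> sets Y"
  shows "AE \<nu> in outside Z. emeasure \<nu> Z = 0"
proof -
  have "(AE \<nu> in outside Z. emeasure \<nu> Z = 0) \<longleftrightarrow>
      (AE \<nu> in law. emeasure (density \<nu> (indicator (space Y - Z))) Z = 0)"
    unfolding outside_def by (rule AE_distr_iff) measurable
  moreover have "emeasure (density \<nu> (indicator (space Y - Z))) Z = 0" if "\<nu> \<in> space law" for \<nu>
  proof -
    have "(space Y - Z) \<inter> Z = {}" by auto
    then show ?thesis using that by (simp add: emeasure_restrict_counting)
  qed
  ultimately show ?thesis by auto
qed

lemma outside_cell:
  assumes "Z \<in> sets Y" "finite S" "S \<subseteq> sets Y" "\<And>A. A \<in> S \<Longrightarrow> A \<inter> Z = {}"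
  shows "measure (outside Z) (cell Y S c) = measure law (cell Y S c)"
proof -
  have "(\<lambda>\<nu>. density \<nu> (indicator (space Y - Z))) -` cell Y S c \<inter> space law = cell Y S c"
  proof -
    have "emeasure (density \<nu> (indicator (space Y - Z))) A = emeasure \<nu> A"
      if "\<nu> \<in> counting_measures Y" "A \<in> S" for \<nu> A
    proof -
      have "(space Y - Z) \<inter> A = A" using assms(3,4) that(2) sets.sets_into_space by blast
      then show ?thesis using that assms by (auto simp: emeasure_restrict_counting)
    qed
    then show ?thesis using assms(1) by (auto simp: cell_def restrict_in_counting_measures)
  qed
  then show ?thesis
    unfolding outside_def using assms by (subst measure_distr) (auto intro: cell_measurable)
qed

lemma finite_intensity_on_restrict:
  assumes Z: "Z \<in> sets Y" "emeasure lam Z \<noteq> \<infinity>"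
  shows "finite_intensity_on (density lam (indicator Z)) Y Z"
proof -
  have "Z \<inter> space lam = Z" using Z sets.sets_into_space[of Z lam] by auto
  moreover have "emeasure (density lam (indicator Z)) (space lam) = emeasure lam (Z \<inter> space lam)"
    using Z by (intro emeasure_restricted) (auto simp: sets.top[of Y])
  ultimately have "emeasure (density lam (indicator Z)) (space (density lam (indicator Z))) \<noteq> \<infinity>"
    using Z(2) by (simp only: space_density not_False_eq_True)
  then have "finite_measure (density lam (indicator Z))" by (rule finite_measureI)
  moreover have "AE x in density lam (indicator Z). x \<in> Z"
    using Z by (subst AE_density) (auto simp: indicator_def)
  ultimately show ?thesis
    unfolding finite_intensity_on_def finite_intensity_def finite_intensity_axioms_def
      finite_intensity_on_axioms_def
    using Z(1) by (intro conjI) simp_all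
qed

text \<open>Compared on cells. Sets outside \<open>Z\<close>, whose intensity may be infinite,
  contribute one common factor that is never computed. Inside \<open>Z\<close>,
  \<open>exp (- total)\<close> splits into one factor per set and turns the multinomial weight into
  a product of Poisson weights.\<close>

lemma law_eq_superpose_poisson:
  assumes ZY: "Z \<in> sets Y" and Z_fin: "emeasure lam Z \<noteq> \<infinity>"
  shows "law = finite_intensity.superpose_poisson (density lam (indicator Z)) Y (outside Z)"
proof -
  define l where "l = density lam (indicator Z)"
  interpret finite_intensity_on l Y Z
    unfolding l_def by (rule finite_intensity_on_restrict[OF ZY Z_fin])
  interpret law: prob_space law by (rule prob_space_law)
  interpret M0: prob_space "outside Z" by (rule prob_space_outside[OF ZY])
  note M0 = M0.finite_measure_axioms sets_outside
  have l: "measure l A = measure lam A" if "A \<in> sets Y" "A \<subseteq> Z" for A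
    using that ZY unfolding l_def by (simp add: measure_def emeasure_restricted Int_absorb1)
  have fin_l: "emeasure lam A \<noteq> \<infinity>" if "A \<subseteq> Z" for A
  proof -
    have "emeasure lam A \<le> emeasure lam Z" using that ZY by (intro emeasure_mono) auto
    then show ?thesis using Z_fin by (auto simp: top_unique)
  qed
  let ?w = "\<lambda>n. exp (- total) / fact n"
  have sp: "emeasure (superpose_poisson (outside Z)) E = (\<Sum>n. ennreal (?w n) * ennreal (measure (insert_points (outside Z) n) E))"
    if "E \<in> sets (counting_measure_space Y)" for E
  proof -
    have "emeasure (insert_points (outside Z) n) E = ennreal (measure (insert_points (outside Z) n) E)" for n
      using finite_measure.emeasure_eq_measure[OF finite_insert_points[OF M0]] .
    then show ?thesis
      unfolding superpose_poisson_def using that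
      by (subst emeasure_sum_measure) (auto simp: sets_insert_points)
  qed
  have "law = superpose_poisson (outside Z)"
  proof (rule counting_measure_space_eqI[OF _ _ _ ZY])
    show "sets law = sets (counting_measure_space Y)" by simp
    show "sets (superpose_poisson (outside Z)) = sets (counting_measure_space Y)"
      by (simp add: superpose_poisson_def)
    show "emeasure law (space law) \<noteq> \<infinity>" by simp
    fix R and c :: "'a set \<Rightarrow> ennreal"
    assume R: "fine_partition Y Z R" and c: "c \<in> R \<rightarrow>\<^sub>E (range of_nat \<union> {\<infinity>})"
    have fin: "finite R" and sub: "R \<subseteq> sets Y" and disj: "disjoint R" and un: "\<Union>R = space Y"
      and fine: "\<And>A. A \<in> R \<Longrightarrow> A \<subseteq> Z \<or> A \<inter> Z = {}"
      using R by (auto simp: fine_partition_def)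
    have cell: "cell Y R c \<in> sets (counting_measure_space Y)"
      using fin sub by (rule cell_measurable)
    let ?RZ = "{A. A \<in> R \<and> A \<subseteq> Z}"
    show "emeasure law (cell Y R c) = emeasure (superpose_poisson (outside Z)) (cell Y R c)"
    \<comment> \<open>An infinite count on a set inside \<open>Z\<close>, which has finite
      intensity, is null under both laws.\<close>
    proof (cases "\<exists>A\<in>?RZ. c A = \<infinity>")
      case True
      then obtain A where A: "A \<in> R" "A \<subseteq> Z" "c A = \<infinity>" by blast
      have AY: "A \<in> sets Y" using A sub by auto
      have "measure law (cell Y {A} c) = 0"
        by (rule law_infinite_value[where c = c, OF AY fin_l[OF A(2)] A(3)])
      then have "measure law (cell Y R c) = 0"
        unfolding law_cell_prod[OF fin sub disj] using A(1) fin by (intro prod_zero) auto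
      moreover have "measure (insert_points (outside Z) n) (cell Y R c) = 0" for n
      proof -
        interpret N: finite_measure "insert_points (outside Z) n" by (rule finite_insert_points[OF M0])
        have "cell Y R c \<subseteq> {\<nu>\<in>counting_measures Y. emeasure \<nu> Z = \<infinity>}"
        proof
          fix \<nu> assume \<nu>: "\<nu> \<in> cell Y R c"
          then have "emeasure \<nu> A \<le> emeasure \<nu> Z"
            using A ZY counting_measures_sets[of \<nu> Y] by (intro emeasure_mono) (auto simp: cell_def)
          then show "\<nu> \<in> {\<nu>\<in>counting_measures Y. emeasure \<nu> Z = \<infinity>}"
            using \<nu> A by (auto simp: cell_def top_unique)
        qed
        moreover have "{\<nu>\<in>space (counting_measure_space Y). emeasure \<nu> Z = \<infinity>} \<in> sets (counting_measure_space Y)"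
          using ZY by measurable
        ultimately have "measure (insert_points (outside Z) n) (cell Y R c) \<le>
            measure (insert_points (outside Z) n) {\<nu>\<in>counting_measures Y. emeasure \<nu> Z = \<infinity>}"
          by (intro N.finite_measure_mono) (auto simp: sets_insert_points)
        then show ?thesis
          using measure_insert_points_infinite[OF M0 AE_outside[OF ZY], of n]
            measure_nonneg[of "insert_points (outside Z) n" "cell Y R c"] by linarith
      qed
      ultimately show ?thesis
        unfolding sp[OF cell] by (simp add: law.emeasure_eq_measure)
    next
      case False
      define k where "k A = (SOME n. c A = of_nat n)" for A
      have k: "c A = of_nat (k A)" if "A \<in> ?RZ" for A
      proof -
        have "\<exists>n. c A = of_nat n" using False that c by (auto simp: PiE_iff)
        then show ?thesis unfolding k_def by (rule someI_ex)
      qed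
      have occ: "cell Y R c = occupancy R c k"
        using k by (auto simp: occupancy_def cell_def)
      let ?N = "\<Sum>A\<in>?RZ. k A"
      let ?p = "measure law (cell Y {A\<in>R. \<not> A \<subseteq> Z} c)"
      let ?W = "\<Prod>A\<in>?RZ. measure l A ^ k A / fact (k A)"
      have p: "measure (outside Z) (cell Y {A\<in>R. \<not> A \<subseteq> Z} c) = ?p"
        using fin sub fine by (intro outside_cell ZY) auto
      \<comment> \<open>The counts prescribed inside \<open>Z\<close> fix the number of inserted
        points, so one term of the mixture survives.\<close>
      have e1: "emeasure (superpose_poisson (outside Z)) (cell Y R c) =
          (\<Sum>n\<in>{?N}. ennreal (?w n) * ennreal (measure (insert_points (outside Z) n) (cell Y R c)))"
        unfolding sp[OF cell] unfolding occ measure_insert_points_occupancy[OF M0 AE_outside[OF ZY] R]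
        by (rule suminf_finite) auto
      have e2: "measure (insert_points (outside Z) ?N) (cell Y R c) = ?p * (fact ?N * ?W)"
        unfolding occ measure_insert_points_occupancy[OF M0 AE_outside[OF ZY] R] p by simp
      have e3: "exp (- total) * ?W = (\<Prod>A\<in>?RZ. measure law (cell Y {A} c))"
      proof -
        have "total = measure l Z"
          using AE_Z ZY by (intro measure_eq_AE) (auto simp: sets.top[of Y])
        moreover have "measure l Z = measure l (\<Union>A\<in>?RZ. A)"
        proof (rule arg_cong[where f = "measure l"])
          show "Z = (\<Union>A\<in>?RZ. A)"
          proof (intro equalityI subsetI)
            fix x assume x: "x \<in> Z"
            then have "x \<in> \<Union>R" using un sets.sets_into_space[OF ZY] by auto
            then obtain A where "A \<in> R" "x \<in> A" by auto
            then show "x \<in> (\<Union>A\<in>?RZ. A)" using fine[of A] x by auto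
          qed auto
        qed
        moreover have "measure l (\<Union>A\<in>?RZ. A) = (\<Sum>A\<in>?RZ. measure l A)"
        proof (rule finite_measure_finite_Union)
          show "disjoint_family_on (\<lambda>A. A) ?RZ"
            using disj unfolding disjoint_family_on_def disjoint_def by simp
        qed (use fin sub in auto)
        ultimately have t: "total = (\<Sum>A\<in>?RZ. measure l A)" by (simp only:)
        have "exp (- total) = (\<Prod>A\<in>?RZ. exp (- measure l A))"
          unfolding t sum_negf[symmetric] using fin by (intro exp_sum) simp
        then have "exp (- total) * ?W = (\<Prod>A\<in>?RZ. exp (- measure l A) * (measure l A ^ k A / fact (k A)))"
          by (simp only: prod.distrib)
        moreover have "\<dots> = (\<Prod>A\<in>?RZ. measure law (cell Y {A} c))"
        proof (rule prod.cong[OF refl])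
          fix A assume A: "A \<in> ?RZ"
          then have "A \<in> sets Y" "A \<subseteq> Z" using sub by auto
          then show "exp (- measure l A) * (measure l A ^ k A / fact (k A)) = measure law (cell Y {A} c)"
            using law_finite_value[where c = c, OF _ fin_l k[OF A]] by (simp add: l)
        qed
        ultimately show ?thesis by (simp only:)
      qed
      have e4: "measure law (cell Y R c) = ?p * (\<Prod>A\<in>?RZ. measure law (cell Y {A} c))"
      proof -
        have "?p = (\<Prod>A\<in>{A\<in>R. \<not> A \<subseteq> Z}. measure law (cell Y {A} c))"
          using fin sub disj by (intro law_cell_prod) (auto simp: disjoint_def)
        moreover have "(\<Prod>A\<in>R. measure law (cell Y {A} c)) =
            (\<Prod>A\<in>{A\<in>R. \<not> A \<subseteq> Z} \<union> ?RZ. measure law (cell Y {A} c))"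
          by (intro prod.cong) auto
        moreover have "\<dots> = (\<Prod>A\<in>{A\<in>R. \<not> A \<subseteq> Z}. measure law (cell Y {A} c)) * (\<Prod>A\<in>?RZ. measure law (cell Y {A} c))"
          using fin by (intro prod.union_disjoint) auto
        ultimately show ?thesis unfolding law_cell_prod[OF fin sub disj] by (simp only:)
      qed
      \<comment> \<open>Here \<open>d\<close> is \<open>fact ?N\<close>: the number of orderings of
        the inserted points cancels the factorial in the Poisson weight.\<close>
      have "e / d * m = r" if "m = p * (d * w)" "e * w = q" "r = p * q" "d \<noteq> 0" for d e m p q r w :: real
        using that by simp
      from this[OF e2 e3 e4 fact_nonzero]
      have "?w ?N * measure (insert_points (outside Z) ?N) (cell Y R c) = measure law (cell Y R c)" .
      moreover have "emeasure (superpose_poisson (outside Z)) (cell Y R c) =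
          ennreal (?w ?N * measure (insert_points (outside Z) ?N) (cell Y R c))"
        unfolding e1 by (subst ennreal_mult) simp_all
      ultimately show ?thesis by (simp only: law.emeasure_eq_measure)
    qed
  qed
  then show ?thesis unfolding l_def .
qed

end

section \<open>Local approximation and association\<close>

text \<open>Stated configuration by configuration, not through a generated sigma-field, so that it
  can be tested against the empty configuration: a local functional is constant on measures without
  mass in \<open>Z\<close>.\<close>

definition local_on :: "'a measure \<Rightarrow> 'a set \<Rightarrow> ('a measure \<Rightarrow> real) \<Rightarrow> bool" where
  "local_on Y Z h \<longleftrightarrow> (\<forall>\<nu>\<in>counting_measures Y. \<forall>\<nu>'\<in>counting_measures Y.
     (\<forall>A\<in>sets Y. A \<subseteq> Z \<longrightarrow> emeasure \<nu> A = emeasure \<nu>' A) \<longrightarrow> h \<nu> = h \<nu>')"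

lemma local_on_combine:
  assumes "local_on Y Z h" "local_on Y Z k"
  shows "local_on Y Z (\<lambda>\<nu>. F (h \<nu>) (k \<nu>))"
  unfolding local_on_def
proof (intro ballI impI)
  fix \<nu> \<nu>' assume "\<nu> \<in> counting_measures Y" "\<nu>' \<in> counting_measures Y"
    and "\<forall>A\<in>sets Y. A \<subseteq> Z \<longrightarrow> emeasure \<nu> A = emeasure \<nu>' A"
  then have "h \<nu> = h \<nu>'" "k \<nu> = k \<nu>'" using assms unfolding local_on_def by blast+
  then show "F (h \<nu>) (k \<nu>) = F (h \<nu>') (k \<nu>')" by simp
qed

lemma local_on_mono: "local_on Y Z h \<Longrightarrow> Z \<subseteq> Z' \<Longrightarrow> local_on Y Z' h"
  unfolding local_on_def by (meson order_trans)

locale exhausted_law = prob_space P for P :: "'a measure measure" +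
  fixes Y :: "'a measure" and D :: "nat \<Rightarrow> 'a set"
  assumes sets_P [simp, measurable_cong]: "sets P = sets (counting_measure_space Y)"
    and D_sets: "\<And>n. D n \<in> sets Y" and D_inc: "incseq D" and D_UN: "(\<Union>n. D n) = space Y"
begin

lemma space_P [simp]: "space P = counting_measures Y"
  using sets_eq_imp_space_eq[OF sets_P] by simp

lemma bounded_functional_integrable:
  assumes "bounded_functional Y C h"
  shows "integrable P h"
proof (rule integrable_const_bound[of _ C])
  show "h \<in> borel_measurable P"
    using assms by (simp add: bounded_functional_def cong: measurable_cong_sets)
qed (use assms in \<open>auto simp: bounded_functional_def\<close>)

definition approximable :: "('a measure \<Rightarrow> real) \<Rightarrow> bool" where
  "approximable u \<longleftrightarrow> integrable P u \<and>
     (\<forall>\<epsilon>>0. \<exists>n C h. bounded_functional Y C h \<and> local_on Y (D n) h \<and> (\<integral>\<nu>. \<bar>u \<nu> - h \<nu>\<bar> \<partial>P) < \<epsilon>)"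

lemma approximableE:
  assumes "approximable u" "\<epsilon> > 0"
  obtains n C h where "bounded_functional Y C h" "local_on Y (D n) h" "(\<integral>\<nu>. \<bar>u \<nu> - h \<nu>\<bar> \<partial>P) < \<epsilon>"
  using assms unfolding approximable_def by blast

lemma approximable_L1_closed:
  assumes u: "integrable P u"
    and v: "\<And>\<epsilon>. \<epsilon> > 0 \<Longrightarrow> \<exists>v. approximable v \<and> (\<integral>\<nu>. \<bar>u \<nu> - v \<nu>\<bar> \<partial>P) < \<epsilon>"
  shows "approximable u"
  unfolding approximable_def
proof (intro conjI allI impI u)
  fix \<epsilon> :: real assume "\<epsilon> > 0"
  then have e: "\<epsilon> / 2 > 0" by simp
  obtain v where v: "approximable v" "(\<integral>\<nu>. \<bar>u \<nu> - v \<nu>\<bar> \<partial>P) < \<epsilon> / 2" using v[OF e] by blast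
  obtain n C h where h: "bounded_functional Y C h" "local_on Y (D n) h" "(\<integral>\<nu>. \<bar>v \<nu> - h \<nu>\<bar> \<partial>P) < \<epsilon> / 2"
    using approximableE[OF v(1) e] by metis
  have int: "integrable P v" "integrable P h"
    using v(1) bounded_functional_integrable[OF h(1)] by (auto simp: approximable_def)
  have "(\<integral>\<nu>. \<bar>u \<nu> - h \<nu>\<bar> \<partial>P) \<le> (\<integral>\<nu>. \<bar>u \<nu> - v \<nu>\<bar> + \<bar>v \<nu> - h \<nu>\<bar> \<partial>P)"
    using u int by (intro integral_mono) auto
  also have "\<dots> = (\<integral>\<nu>. \<bar>u \<nu> - v \<nu>\<bar> \<partial>P) + (\<integral>\<nu>. \<bar>v \<nu> - h \<nu>\<bar> \<partial>P)"
    using u int by (intro Bochner_Integration.integral_add) auto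
  finally have "(\<integral>\<nu>. \<bar>u \<nu> - h \<nu>\<bar> \<partial>P) < \<epsilon>" using v(2) h(3) by linarith
  with h show "\<exists>n C h. bounded_functional Y C h \<and> local_on Y (D n) h \<and> (\<integral>\<nu>. \<bar>u \<nu> - h \<nu>\<bar> \<partial>P) < \<epsilon>"
    by blast
qed

lemma approximable_dominated:
  assumes s: "\<And>i. approximable (s i)"
    and lim: "\<And>\<nu>. \<nu> \<in> counting_measures Y \<Longrightarrow> (\<lambda>i. s i \<nu>) \<longlonglongrightarrow> u \<nu>"
    and bd: "\<And>i \<nu>. \<nu> \<in> counting_measures Y \<Longrightarrow> \<bar>s i \<nu>\<bar> \<le> w \<nu>"
    and w: "integrable P w" and u: "u \<in> borel_measurable P"
  shows "approximable u"
proof (rule approximable_L1_closed)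
  have sm: "s i \<in> borel_measurable P" for i
    using s[of i] by (auto simp: approximable_def)
  have uw: "\<bar>u \<nu>\<bar> \<le> w \<nu>" if "\<nu> \<in> counting_measures Y" for \<nu>
    using tendsto_rabs[OF lim[OF that]] bd[OF that] by (intro LIMSEQ_le_const2) auto
  show "integrable P u"
    using w u by (rule Bochner_Integration.integrable_bound) (use uw in fastforce)
  have "(\<lambda>i. \<integral>\<nu>. \<bar>u \<nu> - s i \<nu>\<bar> \<partial>P) \<longlonglongrightarrow> (\<integral>\<nu>. 0 \<partial>P)"
  proof (rule integral_dominated_convergence)
    show "integrable P (\<lambda>\<nu>. 2 * w \<nu>)" using w by simp
    show "AE \<nu> in P. (\<lambda>i. \<bar>u \<nu> - s i \<nu>\<bar>) \<longlonglongrightarrow> 0"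
    proof (rule AE_I2)
      fix \<nu> assume "\<nu> \<in> space P"
      then have "(\<lambda>i. \<bar>u \<nu> - s i \<nu>\<bar>) \<longlonglongrightarrow> \<bar>u \<nu> - u \<nu>\<bar>"
        by (intro tendsto_intros lim) simp
      then show "(\<lambda>i. \<bar>u \<nu> - s i \<nu>\<bar>) \<longlonglongrightarrow> 0" by simp
    qed
    show "AE \<nu> in P. norm \<bar>u \<nu> - s i \<nu>\<bar> \<le> 2 * w \<nu>" for i
    proof (rule AE_I2)
      fix \<nu> assume "\<nu> \<in> space P"
      then have "\<bar>u \<nu>\<bar> \<le> w \<nu>" "\<bar>s i \<nu>\<bar> \<le> w \<nu>" using uw bd by auto
      then show "norm \<bar>u \<nu> - s i \<nu>\<bar> \<le> 2 * w \<nu>" by simp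
    qed
  qed (use u sm in auto)
  then have lim0: "(\<lambda>i. \<integral>\<nu>. \<bar>u \<nu> - s i \<nu>\<bar> \<partial>P) \<longlonglongrightarrow> 0" by simp
  fix \<epsilon> :: real assume "\<epsilon> > 0"
  with lim0 have "\<forall>\<^sub>F i in sequentially. (\<integral>\<nu>. \<bar>u \<nu> - s i \<nu>\<bar> \<partial>P) < \<epsilon>"
    by (rule order_tendstoD)
  then show "\<exists>v. approximable v \<and> (\<integral>\<nu>. \<bar>u \<nu> - v \<nu>\<bar> \<partial>P) < \<epsilon>"
    using s by (auto simp: eventually_sequentially)
qed

lemma approximable_local:
  assumes "bounded_functional Y C h" "local_on Y (D n) h"
  shows "approximable h"
  unfolding approximable_def
proof (intro conjI allI impI bounded_functional_integrable[OF assms(1)])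
  fix \<epsilon> :: real assume "\<epsilon> > 0"
  then have "(\<integral>\<nu>. \<bar>h \<nu> - h \<nu>\<bar> \<partial>P) < \<epsilon>" by simp
  with assms show "\<exists>n C h'. bounded_functional Y C h' \<and> local_on Y (D n) h' \<and> (\<integral>\<nu>. \<bar>h \<nu> - h' \<nu>\<bar> \<partial>P) < \<epsilon>"
    by blast
qed

lemma approximable_add:
  assumes "approximable u" "approximable v"
  shows "approximable (\<lambda>\<nu>. u \<nu> + v \<nu>)"
  unfolding approximable_def
proof (intro conjI allI impI)
  have uv: "integrable P u" "integrable P v" using assms by (auto simp: approximable_def)
  then show "integrable P (\<lambda>\<nu>. u \<nu> + v \<nu>)" by simp
  fix \<epsilon> :: real assume "\<epsilon> > 0"
  then have e: "\<epsilon> / 2 > 0" by simp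
  obtain n C h where h: "bounded_functional Y C h" "local_on Y (D n) h" "(\<integral>\<nu>. \<bar>u \<nu> - h \<nu>\<bar> \<partial>P) < \<epsilon> / 2"
    using approximableE[OF assms(1) e] by metis
  obtain m B k where k: "bounded_functional Y B k" "local_on Y (D m) k" "(\<integral>\<nu>. \<bar>v \<nu> - k \<nu>\<bar> \<partial>P) < \<epsilon> / 2"
    using approximableE[OF assms(2) e] by metis
  have int: "integrable P h" "integrable P k"
    using bounded_functional_integrable h(1) k(1) by auto
  have b: "bounded_functional Y (C + B) (\<lambda>\<nu>. h \<nu> + k \<nu>)"
    using h(1) k(1) unfolding bounded_functional_def
    by (auto intro!: order_trans[OF abs_triangle_ineq] add_mono)
  have "local_on Y (D (max n m)) h" "local_on Y (D (max n m)) k"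
    using local_on_mono[OF h(2) incseqD[OF D_inc]] local_on_mono[OF k(2) incseqD[OF D_inc]] by simp_all
  then have l: "local_on Y (D (max n m)) (\<lambda>\<nu>. h \<nu> + k \<nu>)"
    by (rule local_on_combine)
  have "(\<integral>\<nu>. \<bar>(u \<nu> + v \<nu>) - (h \<nu> + k \<nu>)\<bar> \<partial>P) \<le> (\<integral>\<nu>. \<bar>u \<nu> - h \<nu>\<bar> + \<bar>v \<nu> - k \<nu>\<bar> \<partial>P)"
    using uv int by (intro integral_mono) auto
  also have "\<dots> = (\<integral>\<nu>. \<bar>u \<nu> - h \<nu>\<bar> \<partial>P) + (\<integral>\<nu>. \<bar>v \<nu> - k \<nu>\<bar> \<partial>P)"
    using uv int by (intro Bochner_Integration.integral_add) auto
  finally have "(\<integral>\<nu>. \<bar>(u \<nu> + v \<nu>) - (h \<nu> + k \<nu>)\<bar> \<partial>P) < \<epsilon>" using h(3) k(3) by linarith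
  with b l show "\<exists>n C h. bounded_functional Y C h \<and> local_on Y (D n) h \<and> (\<integral>\<nu>. \<bar>(u \<nu> + v \<nu>) - h \<nu>\<bar> \<partial>P) < \<epsilon>"
    by blast
qed

lemma approximable_scale:
  assumes "approximable u"
  shows "approximable (\<lambda>\<nu>. c * u \<nu>)"
  unfolding approximable_def
proof (intro conjI allI impI)
  have u: "integrable P u" using assms by (auto simp: approximable_def)
  then show "integrable P (\<lambda>\<nu>. c * u \<nu>)" by simp
  fix \<epsilon> :: real assume "\<epsilon> > 0"
  \<comment> \<open>The added one keeps the tolerance meaningful for \<open>c = 0\<close>.\<close>
  then have e: "\<epsilon> / (\<bar>c\<bar> + 1) > 0" by (simp add: field_simps add_pos_nonneg)
  obtain n C h where h: "bounded_functional Y C h" "local_on Y (D n) h" "(\<integral>\<nu>. \<bar>u \<nu> - h \<nu>\<bar> \<partial>P) < \<epsilon> / (\<bar>c\<bar> + 1)"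
    using approximableE[OF assms(1) e] by metis
  have b: "bounded_functional Y (\<bar>c\<bar> * C) (\<lambda>\<nu>. c * h \<nu>)"
    using h(1) unfolding bounded_functional_def by (auto simp: abs_mult mult_left_mono)
  have l: "local_on Y (D n) (\<lambda>\<nu>. c * h \<nu>)"
    by (rule local_on_combine[OF h(2,2), of "\<lambda>x _. c * x"])
  have "(\<integral>\<nu>. \<bar>c * u \<nu> - c * h \<nu>\<bar> \<partial>P) = \<bar>c\<bar> * (\<integral>\<nu>. \<bar>u \<nu> - h \<nu>\<bar> \<partial>P)"
    by (simp add: abs_mult flip: right_diff_distrib)
  also have "\<dots> \<le> (\<bar>c\<bar> + 1) * (\<integral>\<nu>. \<bar>u \<nu> - h \<nu>\<bar> \<partial>P)"
    by (intro mult_right_mono integral_nonneg_AE) auto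
  also have "\<dots> < \<epsilon>" using h(3) by (simp add: pos_less_divide_eq add_nonneg_pos mult.commute)
  finally show "\<exists>n C h. bounded_functional Y C h \<and> local_on Y (D n) h \<and> (\<integral>\<nu>. \<bar>c * u \<nu> - h \<nu>\<bar> \<partial>P) < \<epsilon>"
    using b l by blast
qed

text \<open>The count of \<open>B\<close> is the increasing limit of the counts of
  \<open>B \<inter> D n\<close>, and events about the latter are local.\<close>

lemma sets_generated_by_local:
  defines "G \<equiv> {E \<in> sets (counting_measure_space Y). \<exists>n. local_on Y (D n) (indicator E)}"
  shows "sets (counting_measure_space Y) = sigma_sets (counting_measures Y) G"
proof
  let ?B = "{(\<lambda>\<mu>. emeasure \<mu> B) -` A \<inter> counting_measures Y |A B. A \<in> sets borel \<and> B \<in> sets Y}"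
  let ?S = "sigma (counting_measures Y) G"
  have GP: "G \<subseteq> Pow (counting_measures Y)"
    using sets.sets_into_space unfolding G_def by force
  have S: "space ?S = counting_measures Y" "sets ?S = sigma_sets (counting_measures Y) G"
    using GP by (auto simp: space_measure_of_conv)
  have 1: "(\<lambda>\<mu>. emeasure \<mu> (B \<inter> D n)) \<in> borel_measurable ?S" if B: "B \<in> sets Y" for B n
  proof (rule measurableI)
    fix A :: "ennreal set" assume A: "A \<in> sets borel"
    have BD: "B \<inter> D n \<in> sets Y" using B D_sets by auto
    let ?E = "(\<lambda>\<mu>. emeasure \<mu> (B \<inter> D n)) -` A \<inter> counting_measures Y"
    have "?E \<in> sets (counting_measure_space Y)"
      using measurable_sets[OF measurable_emeasure_counting[OF BD] A] by simp
    moreover have "local_on Y (D n) (indicator ?E)"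
      unfolding local_on_def using BD by (auto simp: indicator_def)
    ultimately have "?E \<in> G" unfolding G_def by blast
    then show "(\<lambda>\<mu>. emeasure \<mu> (B \<inter> D n)) -` A \<inter> space ?S \<in> sets ?S"
      unfolding S by (rule sigma_sets.Basic)
  qed simp
  have 2: "(\<lambda>\<mu>. emeasure \<mu> B) \<in> borel_measurable ?S" if B: "B \<in> sets Y" for B
  proof (rule measurable_cong[THEN iffD1, rotated])
    show "(\<lambda>\<mu>. SUP n. emeasure \<mu> (B \<inter> D n)) \<in> borel_measurable ?S"
      using 1[OF B] by (intro borel_measurable_SUP) auto
    fix \<mu> assume "\<mu> \<in> space ?S"
    then have "\<mu> \<in> counting_measures Y" by (simp only: S)
    then have sets: "sets \<mu> = sets Y" by (rule counting_measures_sets)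
    have "(SUP n. emeasure \<mu> (B \<inter> D n)) = emeasure \<mu> (\<Union>n. B \<inter> D n)"
      using B D_sets D_inc sets by (intro SUP_emeasure_incseq) (auto simp: incseq_def)
    also have "(\<Union>n. B \<inter> D n) = B" using D_UN sets.sets_into_space[OF B] by auto
    finally show "(SUP n. emeasure \<mu> (B \<inter> D n)) = emeasure \<mu> B" .
  qed
  have "?B \<subseteq> sets ?S"
  proof
    fix E assume "E \<in> ?B"
    then obtain A B where E: "E = (\<lambda>\<mu>. emeasure \<mu> B) -` A \<inter> counting_measures Y" "A \<in> sets borel" "B \<in> sets Y"
      by auto
    show "E \<in> sets ?S" using measurable_sets[OF 2[OF E(3)] E(2)] unfolding E(1) S(1) .
  qed
  then have "sigma_sets (space ?S) ?B \<subseteq> sets ?S" by (rule sets.sigma_sets_subset)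
  moreover have "sets (counting_measure_space Y) = sigma_sets (counting_measures Y) ?B"
    unfolding counting_measure_space_def by (rule sets_measure_of) auto
  ultimately show "sets (counting_measure_space Y) \<subseteq> sigma_sets (counting_measures Y) G"
    unfolding S by simp
  have "sigma_sets (space (counting_measure_space Y)) G \<subseteq> sets (counting_measure_space Y)"
    by (rule sets.sigma_sets_subset) (auto simp: G_def)
  then show "sigma_sets (counting_measures Y) G \<subseteq> sets (counting_measure_space Y)" by simp
qed

text \<open>Dynkin's argument. Local events are intersection-stable because two of them are local on
  the larger of the two sets \<open>D n\<close> and \<open>D m\<close>; complements and disjoint
  unions are handled by linearity and dominated limits.\<close>

lemma approximable_indicator:
  assumes "E \<in> sets (counting_measure_space Y)"
  shows "approximable (indicator E)"
proof -
  let ?G = "{E \<in> sets (counting_measure_space Y). \<exists>n. local_on Y (D n) (indicator E)}"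
  have ind: "approximable (\<lambda>_. 1)"
    by (rule approximable_local[of 1 _ 0]) (auto simp: bounded_functional_def local_on_def)
  have "Int_stable ?G"
  proof (rule Int_stableI)
    fix A B assume "A \<in> ?G" "B \<in> ?G"
    then obtain n m where A: "A \<in> sets (counting_measure_space Y)" "local_on Y (D n) (indicator A)"
      and B: "B \<in> sets (counting_measure_space Y)" "local_on Y (D m) (indicator B)" by blast
    have "local_on Y (D (max n m)) (indicator A)" "local_on Y (D (max n m)) (indicator B)"
      using local_on_mono[OF A(2) incseqD[OF D_inc]] local_on_mono[OF B(2) incseqD[OF D_inc]] by simp_all
    then have "local_on Y (D (max n m)) (\<lambda>\<nu>. indicator A \<nu> * indicator B \<nu>)"
      by (rule local_on_combine)
    then have "local_on Y (D (max n m)) (indicator (A \<inter> B))"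
      by (simp only: indicator_inter_arith[symmetric])
    then show "A \<inter> B \<in> ?G" using A(1) B(1) by blast
  qed
  moreover have "?G \<subseteq> Pow (counting_measures Y)"
    using sets.sets_into_space by force
  moreover have "E \<in> sigma_sets (counting_measures Y) ?G"
    by (rule subsetD[OF equalityD1[OF sets_generated_by_local] assms])
  ultimately show ?thesis
  proof (induction rule: sigma_sets_induct_disjoint)
    case (basic A)
    then show ?case using approximable_local bounded_functional_indicator by blast
  next
    case empty
    show ?case using approximable_scale[OF ind, of 0] by (simp add: indicator_def[abs_def])
  next
    case (compl A)
    have 1: "approximable (\<lambda>\<nu>. 1 + (-1) * indicator A \<nu>)"
      by (intro approximable_add ind approximable_scale compl.IH)
    have A: "A \<in> sets (counting_measure_space Y)"
      by (rule subsetD[OF equalityD2[OF sets_generated_by_local] compl.hyps(1)])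
    show ?case
    \<comment> \<open>A constant sequence serves to change the functional off
      \<open>counting_measures Y\<close>, where \<open>1 - indicator A\<close> differs from the
      indicator of the complement.\<close>
    proof (rule approximable_dominated[OF 1, where w = "\<lambda>_. 1"])
      show "(\<lambda>i. 1 + (-1) * indicator A \<nu> :: real) \<longlonglongrightarrow> indicator (counting_measures Y - A) \<nu>"
        if "\<nu> \<in> counting_measures Y" for \<nu>
        using that by (simp add: indicator_def)
      have "space P - A \<in> sets P" using A by (intro sets.compl_sets) simp
      then show "(indicator (counting_measures Y - A) :: _ \<Rightarrow> real) \<in> borel_measurable P" by simp
    qed (simp_all add: indicator_def)
  next
    case (union A)
    have A: "A i \<in> sets (counting_measure_space Y)" for i
      by (rule subsetD[OF equalityD2[OF sets_generated_by_local]]) (use union.hyps(2) in blast)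
    have disj: "\<And>i j. i \<noteq> j \<Longrightarrow> A i \<inter> A j = {}" using union.hyps(1) by (auto simp: disjoint_family_on_def)
    have sums: "(\<lambda>i. indicator (A i) \<nu> :: real) sums indicator (\<Union>i. A i) \<nu>" for \<nu>
      using disj by (rule indicator_sums)
    show ?case
    proof (rule approximable_dominated[where w = "\<lambda>_. 1"])
      show "approximable (\<lambda>\<nu>. \<Sum>i<k. indicator (A i) \<nu>)" for k
      proof (induction k)
        case 0
        show ?case using approximable_scale[OF ind, of 0] by simp
      next
        case (Suc k)
        then show ?case using approximable_add[OF Suc union.IH[of k]] by simp
      qed
      show "(\<lambda>k. \<Sum>i<k. indicator (A i) \<nu> :: real) \<longlonglongrightarrow> indicator (\<Union>i. A i) \<nu>" for \<nu>
        using sums by (simp add: sums_def)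
      show "\<bar>\<Sum>i<k. indicator (A i) \<nu> :: real\<bar> \<le> 1" for k \<nu>
      proof -
        have "(\<Sum>i<k. indicator (A i) \<nu> :: real) \<le> (\<Sum>i. indicator (A i) \<nu>)"
          using sums_summable[OF sums] by (intro sum_le_suminf) auto
        also have "\<dots> = indicator (\<Union>i. A i) \<nu>" using sums_unique[OF sums] by simp
        also have "\<dots> \<le> 1" by (simp add: indicator_def)
        finally show ?thesis by (simp add: sum_nonneg)
      qed
    qed (use A in auto)
  qed
qed

lemma integrable_approximable:
  assumes "integrable P u"
  shows "approximable u"
  using assms
proof (induction rule: integrable_induct)
  case (base A c)
  then have "approximable (indicator A)" by (intro approximable_indicator) simp
  from approximable_scale[OF this, of c] show ?case by (simp only: real_scaleR_def mult.commute)
next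
  case (add f g)
  show ?case by (rule approximable_add[OF add.IH])
next
  case (lim f s)
  show ?case
  proof (rule approximable_dominated[OF lim.IH])
    show "(\<lambda>i. s i \<nu>) \<longlonglongrightarrow> f \<nu>" if "\<nu> \<in> counting_measures Y" for \<nu>
      using lim.hyps(2) that by simp
    show "\<bar>s i \<nu>\<bar> \<le> 2 * \<bar>f \<nu>\<bar>" if "\<nu> \<in> counting_measures Y" for i \<nu>
      using lim.hyps(3)[of \<nu> i] that by simp
    show "integrable P (\<lambda>\<nu>. 2 * \<bar>f \<nu>\<bar>)" using lim.hyps(4) by simp
    show "f \<in> borel_measurable P" using lim.hyps(4) by (rule borel_measurable_integrable)
  qed
qed

end

section \<open>Bounds, contraction and locality for Poisson insertion\<close>

context finite_intensity
begin

lemma funpow_insert_point_summable: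
  assumes f: "bounded_functional Y C f" and \<nu>: "\<nu> \<in> counting_measures Y"
  shows "summable (\<lambda>n. (insert_point ^^ n) f \<nu> / fact n)"
proof (rule summable_comparison_test)
  have "\<bar>(insert_point ^^ n) f \<nu>\<bar> \<le> C * total ^ n" for n
    using funpow_insert_point_bounded[OF f] \<nu> by (auto simp: bounded_functional_def)
  then show "\<exists>N. \<forall>n\<ge>N. norm ((insert_point ^^ n) f \<nu> / fact n) \<le> C * total ^ n / fact n"
    by (auto intro!: divide_right_mono)
  show "summable (\<lambda>n. C * total ^ n / fact n)"
    using summable_mult[OF summable_exp[of total], of C] by (simp add: field_simps)
qed

lemma add_poisson_bound:
  assumes f: "bounded_functional Y C f" and \<nu>: "\<nu> \<in> counting_measures Y"
  shows "\<bar>add_poisson f \<nu>\<bar> \<le> C"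
proof (rule LIMSEQ_le_const2)
  show "(\<lambda>m. \<bar>(add_bernoulli (1 / real m) ^^ m) f \<nu>\<bar>) \<longlonglongrightarrow> \<bar>add_poisson f \<nu>\<bar>"
    by (intro tendsto_rabs add_poisson_limit[OF f \<nu>])
  show "\<exists>N. \<forall>m\<ge>N. \<bar>(add_bernoulli (1 / real m) ^^ m) f \<nu>\<bar> \<le> C"
  proof (intro exI[of _ "Suc (nat \<lceil>total\<rceil>)"] allI impI)
    fix m :: nat assume "Suc (nat \<lceil>total\<rceil>) \<le> m"
    then have m: "0 < m" "total \<le> real m" by linarith+
    then have "1 / real m * total \<le> 1" by (simp add: field_simps)
    then show "\<bar>(add_bernoulli (1 / real m) ^^ m) f \<nu>\<bar> \<le> C"
      using funpow_add_bernoulli_bounded[OF f, of "1 / real m" m] \<nu> by (simp add: bounded_functional_def)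
  qed
qed

lemma bounded_functional_abs_diff:
  assumes "bounded_functional Y C f" "bounded_functional Y B h"
  shows "bounded_functional Y (C + B) (\<lambda>\<nu>. \<bar>f \<nu> - h \<nu>\<bar>)"
  unfolding bounded_functional_def
proof (intro conjI ballI)
  show "(\<lambda>\<nu>. \<bar>f \<nu> - h \<nu>\<bar>) \<in> borel_measurable (counting_measure_space Y)"
    using assms by (auto simp: bounded_functional_def)
  fix \<nu> assume "\<nu> \<in> counting_measures Y"
  then have "\<bar>f \<nu>\<bar> \<le> C" "\<bar>h \<nu>\<bar> \<le> B" using assms by (auto simp: bounded_functional_def)
  then show "\<bar>\<bar>f \<nu> - h \<nu>\<bar>\<bar> \<le> C + B" by linarith
qed

lemma funpow_insert_point_diff:
  assumes f: "bounded_functional Y C f" and h: "bounded_functional Y B h" and \<nu>: "\<nu> \<in> counting_measures Y"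
  shows "\<bar>(insert_point ^^ n) f \<nu> - (insert_point ^^ n) h \<nu>\<bar> \<le> (insert_point ^^ n) (\<lambda>\<nu>. \<bar>f \<nu> - h \<nu>\<bar>) \<nu>"
  using \<nu>
proof (induction n arbitrary: \<nu>)
  case (Suc n)
  let ?F = "(insert_point ^^ n) f" and ?H = "(insert_point ^^ n) h" and ?K = "(insert_point ^^ n) (\<lambda>\<nu>. \<bar>f \<nu> - h \<nu>\<bar>)"
  note int = integrable_add_point[OF funpow_insert_point_bounded _, OF _ Suc.prems]
  have "\<bar>insert_point ?F \<nu> - insert_point ?H \<nu>\<bar> =
      \<bar>\<integral>x. ?F (add_measure \<nu> (return Y x)) - ?H (add_measure \<nu> (return Y x)) \<partial>l\<bar>"
    unfolding insert_point_def[of ?F] insert_point_def[of ?H] using int[OF f] int[OF h] by simp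
  also have "\<dots> \<le> (\<integral>x. \<bar>?F (add_measure \<nu> (return Y x)) - ?H (add_measure \<nu> (return Y x))\<bar> \<partial>l)"
    by (rule integral_abs_bound)
  also have "\<dots> \<le> insert_point ?K \<nu>"
    unfolding insert_point_def[of ?K]
    using int[OF f] int[OF h] int[OF bounded_functional_abs_diff[OF f h]]
    by (intro integral_mono integrable_abs Bochner_Integration.integrable_diff Suc.IH)
      (auto intro: add_dirac_in_counting_measures[OF Suc.prems])
  finally show ?case by simp
qed simp

text \<open>Insertion is linear and positive. Integrated over the outside process, the inequality
  makes \<open>add_poisson\<close> an L1 contraction, as befits a conditional expectation.\<close>

lemma add_poisson_diff:
  assumes f: "bounded_functional Y C f" and h: "bounded_functional Y B h" and \<nu>: "\<nu> \<in> counting_measures Y"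
  shows "\<bar>add_poisson f \<nu> - add_poisson h \<nu>\<bar> \<le> add_poisson (\<lambda>\<nu>. \<bar>f \<nu> - h \<nu>\<bar>) \<nu>"
proof -
  let ?t = "\<lambda>f n. (insert_point ^^ n) f \<nu> / fact n"
  note sm = funpow_insert_point_summable[OF _ \<nu>]
  have le: "\<bar>?t f n - ?t h n\<bar> \<le> ?t (\<lambda>\<nu>. \<bar>f \<nu> - h \<nu>\<bar>) n" for n
    using funpow_insert_point_diff[OF f h \<nu>, of n]
    by (simp add: divide_right_mono flip: diff_divide_distrib)
  have sm1: "summable (\<lambda>n. \<bar>?t f n - ?t h n\<bar>)"
    by (rule summable_comparison_test[OF _ sm[OF bounded_functional_abs_diff[OF f h]]]) (use le in auto)
  have "\<bar>(\<Sum>n. ?t f n) - (\<Sum>n. ?t h n)\<bar> = \<bar>\<Sum>n. ?t f n - ?t h n\<bar>"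
    using suminf_diff[OF sm[OF f] sm[OF h]] by simp
  also have "\<dots> \<le> (\<Sum>n. \<bar>?t f n - ?t h n\<bar>)" by (rule summable_rabs[OF sm1])
  also have "\<dots> \<le> (\<Sum>n. ?t (\<lambda>\<nu>. \<bar>f \<nu> - h \<nu>\<bar>) n)"
    by (rule suminf_le[OF le sm1 sm[OF bounded_functional_abs_diff[OF f h]]])
  finally show ?thesis
    unfolding add_poisson_def right_diff_distrib[symmetric] abs_mult by simp
qed

text \<open>Adding the same point to two configurations that agree inside \<open>Z\<close> keeps
  them in agreement there.\<close>

lemma insert_point_local:
  assumes "local_on Y Z h"
  shows "local_on Y Z (insert_point h)"
  unfolding local_on_def
proof (intro ballI impI)
  fix \<nu> \<nu>' assume \<nu>: "\<nu> \<in> counting_measures Y" "\<nu>' \<in> counting_measures Y"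
    and eq: "\<forall>A\<in>sets Y. A \<subseteq> Z \<longrightarrow> emeasure \<nu> A = emeasure \<nu>' A"
  have "h (add_measure \<nu> (return Y x)) = h (add_measure \<nu>' (return Y x))" if "x \<in> space Y" for x
  proof -
    have "\<forall>A\<in>sets Y. A \<subseteq> Z \<longrightarrow>
        emeasure (add_measure \<nu> (return Y x)) A = emeasure (add_measure \<nu>' (return Y x)) A"
      using eq \<nu> by (simp add: emeasure_add_point)
    then show ?thesis
      using assms add_dirac_in_counting_measures[OF \<nu>(1) that] add_dirac_in_counting_measures[OF \<nu>(2) that]
      unfolding local_on_def by blast
  qed
  then show "insert_point h \<nu> = insert_point h \<nu>'"
    unfolding insert_point_def by (intro Bochner_Integration.integral_cong) auto
qed

lemma add_poisson_local:
  assumes "local_on Y Z h"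
  shows "local_on Y Z (add_poisson h)"
proof -
  have loc: "local_on Y Z ((insert_point ^^ n) h)" for n
    by (induction n) (simp_all add: assms insert_point_local)
  show ?thesis
    unfolding local_on_def
  proof (intro ballI impI)
    fix \<nu> \<nu>' assume "\<nu> \<in> counting_measures Y" "\<nu>' \<in> counting_measures Y"
      and "\<forall>A\<in>sets Y. A \<subseteq> Z \<longrightarrow> emeasure \<nu> A = emeasure \<nu>' A"
    then have "(insert_point ^^ n) h \<nu> = (insert_point ^^ n) h \<nu>'" for n
      using loc[of n] unfolding local_on_def by blast
    then show "add_poisson h \<nu> = add_poisson h \<nu>'" by (simp only: add_poisson_def)
  qed
qed

end

text \<open>The empty configuration is the reference point for local functionals; its existence also
  makes the bound of a bounded functional nonnegative.\<close>

lemma null_measure_in_counting_measures: "null_measure Y \<in> counting_measures Y"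
proof -
  have "finite_measure (null_measure Y)" by (rule finite_measureI) simp
  then have "sigma_finite_measure (null_measure Y)" by (simp add: finite_measure_def)
  moreover have "(0 :: ennreal) = of_nat 0" by simp
  ultimately show ?thesis by (auto simp: counting_measures_def intro!: image_eqI)
qed

section \<open>Association for bounded functionals\<close>

context poisson_law
begin

text \<open>With \<open>Z = D n\<close>, \<open>add_poisson f\<close> under \<open>outside Z\<close> is the conditional expectation of \<open>f\<close> given the
  process outside \<open>Z\<close>. It is nearly constant for large \<open>n\<close>, because \<open>f\<close> is nearly local.\<close>
lemma association_bounded:
  assumes sf: "sigma_finite_measure lam" and B: "B \<in> sets Y"
    and f: "bounded_functional Y C f" "mixed_monotone Y B f" "\<And>\<nu>. \<nu> \<in> counting_measures Y \<Longrightarrow> 0 \<le> f \<nu>"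
    and g: "bounded_functional Y C g" "mixed_monotone Y B g" "\<And>\<nu>. \<nu> \<in> counting_measures Y \<Longrightarrow> 0 \<le> g \<nu>"
  shows "(\<integral>\<nu>. f \<nu> \<partial>law) * (\<integral>\<nu>. g \<nu> \<partial>law) \<le> (\<integral>\<nu>. f \<nu> * g \<nu> \<partial>law)"
proof (rule field_le_epsilon)
  fix e :: real assume "0 < e"
  obtain D where D: "range D \<subseteq> sets lam" "(\<Union>n. D n) = space lam" "\<And>n. emeasure lam (D n) \<noteq> \<infinity>" "incseq D"
    using sigma_finite_measure.sigma_finite_incseq[OF sf] by metis
  interpret law: exhausted_law law Y D
    unfolding exhausted_law_def exhausted_law_axioms_def
    using prob_space_law D by auto
  have C: "0 \<le> C"
    using f(1) null_measure_in_counting_measures[of Y] abs_ge_zero order_trans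
    unfolding bounded_functional_def by blast
  \<comment> \<open>The total error will be \<open>2 * C * \<epsilon>\<close>; adding one to
    \<open>C\<close> covers \<open>C = 0\<close>.\<close>
  define \<epsilon> where "\<epsilon> = e / (2 * (C + 1))"
  have \<epsilon>: "0 < \<epsilon>" using \<open>0 < e\<close> C by (simp add: \<epsilon>_def)
  have e: "2 * C * \<epsilon> \<le> e" using \<open>0 < e\<close> C by (simp add: \<epsilon>_def field_simps)
  obtain n K h where h: "bounded_functional Y K h" "local_on Y (D n) h" "(\<integral>\<nu>. \<bar>f \<nu> - h \<nu>\<bar> \<partial>law) < \<epsilon>"
    using law.approximableE[OF law.integrable_approximable[OF law.bounded_functional_integrable[OF f(1)]] \<epsilon>] by metis
  define Z where "Z = D n"
  have Z: "Z \<in> sets Y" "emeasure lam Z \<noteq> \<infinity>" using D by (auto simp: Z_def)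
  define l where "l = density lam (indicator Z)"
  interpret l: finite_intensity_on l Y Z
    unfolding l_def by (rule finite_intensity_on_restrict[OF Z])
  interpret M0: prob_space "outside Z" by (rule prob_space_outside[OF Z(1)])
  note M0 = M0.finite_measure_axioms sets_outside[of Z]
  have sp: "space (outside Z) = counting_measures Y"
    using sets_eq_imp_space_eq[OF sets_outside[of Z]] by simp
  let ?L = l.add_poisson
  have L: "integrable (outside Z) (?L u)" "(\<integral>\<nu>. ?L u \<nu> \<partial>outside Z) = (\<integral>\<nu>. u \<nu> \<partial>law)"
    if "bounded_functional Y A u" "\<And>\<nu>. \<nu> \<in> counting_measures Y \<Longrightarrow> 0 \<le> u \<nu>" for A u
    using l.integral_superpose_poisson[OF that M0] law_eq_superpose_poisson[OF Z] unfolding l_def by auto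
  note Lf = L[OF f(1,3)] and Lg = L[OF g(1,3)]
  note fg = bounded_functional_mult[OF f(1) g(1)]
  have Lfg: "integrable (outside Z) (?L (\<lambda>\<nu>. f \<nu> * g \<nu>))"
    "(\<integral>\<nu>. ?L (\<lambda>\<nu>. f \<nu> * g \<nu>) \<nu> \<partial>outside Z) = (\<integral>\<nu>. f \<nu> * g \<nu> \<partial>law)"
    using L[OF fg] f(3) g(3) by auto
  note fh = l.bounded_functional_abs_diff[OF f(1) h(1)]
  have Lfh: "integrable (outside Z) (?L (\<lambda>\<nu>. \<bar>f \<nu> - h \<nu>\<bar>))"
    "(\<integral>\<nu>. ?L (\<lambda>\<nu>. \<bar>f \<nu> - h \<nu>\<bar>) \<nu> \<partial>outside Z) = (\<integral>\<nu>. \<bar>f \<nu> - h \<nu>\<bar> \<partial>law)"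
    using L[OF fh] by auto
  \<comment> \<open>Under \<open>outside Z\<close> the configuration inside \<open>Z\<close> is
    almost surely empty, so the Poisson mean of the local \<open>h\<close> takes the value it has at
    the null measure.\<close>
  define c where "c = ?L h (null_measure Y)"
  have Lh: "AE \<nu> in outside Z. ?L h \<nu> = c"
    using AE_outside[OF Z(1)] AE_space
  proof eventually_elim
    case (elim \<nu>)
    then have \<nu>: "\<nu> \<in> counting_measures Y" by (simp add: sp)
    have "emeasure \<nu> A = emeasure (null_measure Y) A" if "A \<in> sets Y" "A \<subseteq> Z" for A
    proof -
      have "emeasure \<nu> A \<le> emeasure \<nu> Z"
        using that Z(1) counting_measures_sets[OF \<nu>] by (intro emeasure_mono) auto
      then show ?thesis using elim by simp
    qed
    then show ?case
      using l.add_poisson_local[OF h(2)] \<nu> null_measure_in_counting_measures[of Y]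
      unfolding local_on_def c_def Z_def[symmetric] by blast
  qed
  have d: "(\<integral>\<nu>. \<bar>?L f \<nu> - c\<bar> \<partial>outside Z) \<le> \<epsilon>"
  proof -
    have "(\<integral>\<nu>. \<bar>?L f \<nu> - c\<bar> \<partial>outside Z) \<le> (\<integral>\<nu>. ?L (\<lambda>\<nu>. \<bar>f \<nu> - h \<nu>\<bar>) \<nu> \<partial>outside Z)"
    proof (rule integral_mono_AE)
      show "AE \<nu> in outside Z. \<bar>?L f \<nu> - c\<bar> \<le> ?L (\<lambda>\<nu>. \<bar>f \<nu> - h \<nu>\<bar>) \<nu>"
        using Lh AE_space
      proof eventually_elim
        case (elim \<nu>)
        then show ?case using l.add_poisson_diff[OF f(1) h(1), of \<nu>] by (simp add: sp)
      qed
    qed (use Lf(1) Lfh(1) in auto)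
    then show ?thesis using Lfh(2) h(3) by linarith
  qed
  let ?Ef = "\<integral>\<nu>. f \<nu> \<partial>law" and ?Eg = "\<integral>\<nu>. g \<nu> \<partial>law"
  have "\<bar>?Ef - c\<bar> = \<bar>\<integral>\<nu>. ?L f \<nu> - c \<partial>outside Z\<bar>"
    using Lf M0.prob_space by simp
  also have "\<dots> \<le> (\<integral>\<nu>. \<bar>?L f \<nu> - c\<bar> \<partial>outside Z)" by (rule integral_abs_bound)
  finally have c: "\<bar>?Ef - c\<bar> \<le> \<epsilon>" using d by linarith
  \<comment> \<open>One \<open>\<epsilon>\<close> is the distance from \<open>?L f\<close> to
    \<open>c\<close>, the other that from \<open>c\<close> to the mean \<open>?Ef\<close>.\<close>
  have d2: "(\<integral>\<nu>. \<bar>?L f \<nu> - ?Ef\<bar> \<partial>outside Z) \<le> 2 * \<epsilon>"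
  proof -
    have "(\<integral>\<nu>. \<bar>?L f \<nu> - ?Ef\<bar> \<partial>outside Z) \<le> (\<integral>\<nu>. \<bar>?L f \<nu> - c\<bar> + \<epsilon> \<partial>outside Z)"
      using Lf(1) c by (intro integral_mono) auto
    also have "\<dots> = (\<integral>\<nu>. \<bar>?L f \<nu> - c\<bar> \<partial>outside Z) + \<epsilon>"
      using Lf(1) M0.prob_space by simp
    finally show ?thesis using d by linarith
  qed
  have int: "integrable (outside Z) (\<lambda>\<nu>. ?Ef * ?L g \<nu> - C * \<bar>?L f \<nu> - ?Ef\<bar>)"
    using Lf(1) Lg(1) by auto
  have "?Ef * ?Eg - C * (2 * \<epsilon>) \<le> ?Ef * ?Eg - C * (\<integral>\<nu>. \<bar>?L f \<nu> - ?Ef\<bar> \<partial>outside Z)"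
    using mult_left_mono[OF d2 C] by linarith
  also have "\<dots> = (\<integral>\<nu>. ?Ef * ?L g \<nu> - C * \<bar>?L f \<nu> - ?Ef\<bar> \<partial>outside Z)"
    using Lf(1) Lg by simp
  \<comment> \<open>Pointwise, \<open>?L f\<close> is exchanged for the constant \<open>?Ef\<close>
    at a cost of at most \<open>C\<close> times their distance, and then the conditional correlation
    inequality applies.\<close>
  also have "\<dots> \<le> (\<integral>\<nu>. ?L (\<lambda>\<nu>. f \<nu> * g \<nu>) \<nu> \<partial>outside Z)"
  proof (rule integral_mono[OF int Lfg(1)])
    fix \<nu> assume "\<nu> \<in> space (outside Z)"
    then have \<nu>: "\<nu> \<in> counting_measures Y" by (simp add: sp)
    have "\<bar>(?L f \<nu> - ?Ef) * ?L g \<nu>\<bar> \<le> \<bar>?L f \<nu> - ?Ef\<bar> * C"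
      unfolding abs_mult using l.add_poisson_bound[OF g(1) \<nu>] by (intro mult_left_mono) auto
    then have "?Ef * ?L g \<nu> - C * \<bar>?L f \<nu> - ?Ef\<bar> \<le> ?L f \<nu> * ?L g \<nu>"
      by (simp add: algebra_simps abs_le_iff)
    also have "\<dots> \<le> ?L (\<lambda>\<nu>. f \<nu> * g \<nu>) \<nu>"
      by (rule l.add_poisson_mult[OF f(1,2) g(1,2) B \<nu>])
    finally show "?Ef * ?L g \<nu> - C * \<bar>?L f \<nu> - ?Ef\<bar> \<le> ?L (\<lambda>\<nu>. f \<nu> * g \<nu>) \<nu>" .
  qed
  also have "\<dots> = (\<integral>\<nu>. f \<nu> * g \<nu> \<partial>law)" by (rule Lfg(2))
  finally show "?Ef * ?Eg \<le> (\<integral>\<nu>. f \<nu> * g \<nu> \<partial>law) + e" using e by linarith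
qed

section \<open>From bounded to square-integrable functionals\<close>

definition truncate :: "nat \<Rightarrow> ('a measure \<Rightarrow> real) \<Rightarrow> 'a measure \<Rightarrow> real" where
  "truncate n f \<nu> = max (- real n) (min (real n) (f \<nu>))"

lemma truncate_abs_le: "\<bar>truncate n f \<nu>\<bar> \<le> real n" "\<bar>truncate n f \<nu>\<bar> \<le> \<bar>f \<nu>\<bar>"
  by (auto simp: truncate_def)

lemma truncate_measurable [measurable]:
  "f \<in> borel_measurable N \<Longrightarrow> truncate n f \<in> borel_measurable N"
  unfolding truncate_def[abs_def] by (intro borel_measurable_max borel_measurable_min) auto

lemma truncate_tendsto: "(\<lambda>n. truncate n f \<nu>) \<longlonglongrightarrow> f \<nu>"
proof (rule tendsto_eventually)
  show "\<forall>\<^sub>F n in sequentially. truncate n f \<nu> = f \<nu>"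
    using eventually_ge_at_top[of "nat \<lceil>\<bar>f \<nu>\<bar>\<rceil>"]
  proof eventually_elim
    case (elim n)
    then have "\<bar>f \<nu>\<bar> \<le> real n" by linarith
    then show ?case by (simp add: truncate_def abs_le_iff)
  qed
qed

text \<open>Clamping is monotone, so mixed monotonicity survives it. The shift by
  \<open>real n\<close> supplies the nonnegativity asked for by \<open>association_bounded\<close>
  and leaves covariances unchanged.\<close>

lemma association_truncate:
  assumes sf: "sigma_finite_measure lam" and B: "B \<in> sets Y"
    and f: "f \<in> borel_measurable (counting_measure_space Y)" "mixed_monotone Y B f"
    and g: "g \<in> borel_measurable (counting_measure_space Y)" "mixed_monotone Y B g"
  shows "(\<integral>\<nu>. truncate n f \<nu> \<partial>law) * (\<integral>\<nu>. truncate n g \<nu> \<partial>law) \<le>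
    (\<integral>\<nu>. truncate n f \<nu> * truncate n g \<nu> \<partial>law)"
proof -
  interpret law: prob_space law by (rule prob_space_law)
  define s where "s u \<nu> = truncate n u \<nu> + real n" for u :: "'a measure \<Rightarrow> real" and \<nu>
  have s_bd: "bounded_functional Y (2 * real n) (s u)" if "u \<in> borel_measurable (counting_measure_space Y)" for u
    unfolding bounded_functional_def
  proof (intro conjI ballI)
    show "s u \<in> borel_measurable (counting_measure_space Y)"
      using that unfolding s_def[abs_def] by measurable
    fix \<nu> show "\<bar>s u \<nu>\<bar> \<le> 2 * real n" using truncate_abs_le(1)[of n u \<nu>] unfolding s_def by linarith
  qed
  have s_nn: "0 \<le> s u \<nu>" for u \<nu>
    using truncate_abs_le(1)[of n u \<nu>] unfolding s_def by linarith
  have s_mono: "mixed_monotone Y B (s u)" if "mixed_monotone Y B u" for u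
  proof -
    have "s u \<mu> \<le> s u \<nu>" if "u \<mu> \<le> u \<nu>" for \<mu> \<nu>
      using that unfolding s_def truncate_def by auto
    then show ?thesis
      using that unfolding mixed_monotone_def increasing_on_def decreasing_on_def by simp
  qed
  have tm: "truncate n u \<in> borel_measurable law" if "u \<in> borel_measurable (counting_measure_space Y)" for u
    using truncate_measurable[OF that] by (simp cong: measurable_cong_sets)
  have ti: "integrable law (truncate n u)" if "u \<in> borel_measurable (counting_measure_space Y)" for u
    using tm[OF that] truncate_abs_le(1)[of n u] by (intro law.integrable_const_bound[of _ "real n"]) auto
  have tt: "integrable law (\<lambda>\<nu>. truncate n f \<nu> * truncate n g \<nu>)"
  proof (rule law.integrable_const_bound[of _ "real n * real n"])
    show "AE \<nu> in law. norm (truncate n f \<nu> * truncate n g \<nu>) \<le> real n * real n"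
      unfolding norm_mult using truncate_abs_le(1) by (intro AE_I2 mult_mono) auto
  qed (use tm f g in auto)
  have "(\<integral>\<nu>. s f \<nu> \<partial>law) * (\<integral>\<nu>. s g \<nu> \<partial>law) \<le> (\<integral>\<nu>. s f \<nu> * s g \<nu> \<partial>law)"
    using f g by (intro association_bounded[OF sf B, of "2 * real n"] s_bd s_mono s_nn)
  moreover have "(\<integral>\<nu>. s u \<nu> \<partial>law) = (\<integral>\<nu>. truncate n u \<nu> \<partial>law) + real n"
    if "u \<in> borel_measurable (counting_measure_space Y)" for u
    unfolding s_def using ti[OF that] law.prob_space by simp
  moreover have "(\<integral>\<nu>. s f \<nu> * s g \<nu> \<partial>law) = (\<integral>\<nu>. truncate n f \<nu> * truncate n g \<nu> \<partial>law) +
      real n * (\<integral>\<nu>. truncate n f \<nu> \<partial>law) + real n * (\<integral>\<nu>. truncate n g \<nu> \<partial>law) + real n * real n"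
  proof -
    have "s f \<nu> * s g \<nu> = truncate n f \<nu> * truncate n g \<nu> + real n * truncate n f \<nu> + real n * truncate n g \<nu> + real n * real n" for \<nu>
      unfolding s_def by (simp add: algebra_simps)
    then show ?thesis using ti[OF f(1)] ti[OF g(1)] tt law.prob_space by simp
  qed
  ultimately show ?thesis using f(1) g(1) by (simp add: algebra_simps)
qed

lemma association:
  assumes sf: "sigma_finite_measure lam" and B: "B \<in> sets Y"
    and f: "f \<in> L2_space law" "mixed_monotone Y B f" and g: "g \<in> L2_space law" "mixed_monotone Y B g"
  shows "(\<integral>\<nu>. f \<nu> \<partial>law) * (\<integral>\<nu>. g \<nu> \<partial>law) \<le> (\<integral>\<nu>. f \<nu> * g \<nu> \<partial>law)"
proof (rule LIMSEQ_le)
  interpret law: prob_space law by (rule prob_space_law)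
  have m [measurable]: "f \<in> borel_measurable law" "g \<in> borel_measurable law"
    and sq: "integrable law (\<lambda>\<nu>. (f \<nu>)\<^sup>2)" "integrable law (\<lambda>\<nu>. (g \<nu>)\<^sup>2)"
    using f(1) g(1) by (auto simp: L2_space_def)
  have lim1: "(\<lambda>n. \<integral>\<nu>. truncate n u \<nu> \<partial>law) \<longlonglongrightarrow> (\<integral>\<nu>. u \<nu> \<partial>law)"
    if [measurable]: "u \<in> borel_measurable law" and "integrable law (\<lambda>\<nu>. (u \<nu>)\<^sup>2)" for u
  proof (rule integral_dominated_convergence)
    show "integrable law (\<lambda>\<nu>. \<bar>u \<nu>\<bar>)"
      using law.square_integrable_imp_integrable[OF that] by simp
  qed (use truncate_abs_le truncate_tendsto in auto)
  show "(\<lambda>n. (\<integral>\<nu>. truncate n f \<nu> \<partial>law) * (\<integral>\<nu>. truncate n g \<nu> \<partial>law)) \<longlonglongrightarrow>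
      (\<integral>\<nu>. f \<nu> \<partial>law) * (\<integral>\<nu>. g \<nu> \<partial>law)"
    by (intro tendsto_mult lim1 m sq)
  show "(\<lambda>n. \<integral>\<nu>. truncate n f \<nu> * truncate n g \<nu> \<partial>law) \<longlonglongrightarrow> (\<integral>\<nu>. f \<nu> * g \<nu> \<partial>law)"
  proof (rule integral_dominated_convergence)
    \<comment> \<open>Truncation never increases absolute values, and
      \<open>2 * (\<bar>f \<nu>\<bar> * \<bar>g \<nu>\<bar>)\<close> is at most this sum of squares,
      so it majorises the products for all \<open>n\<close> at once.\<close>
    show "integrable law (\<lambda>\<nu>. (f \<nu>)\<^sup>2 + (g \<nu>)\<^sup>2)" using sq by simp
    show "AE \<nu> in law. (\<lambda>n. truncate n f \<nu> * truncate n g \<nu>) \<longlonglongrightarrow> f \<nu> * g \<nu>"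
      by (intro AE_I2 tendsto_mult truncate_tendsto)
    show "AE \<nu> in law. norm (truncate n f \<nu> * truncate n g \<nu>) \<le> (f \<nu>)\<^sup>2 + (g \<nu>)\<^sup>2" for n
    proof (rule AE_I2)
      fix \<nu>
      have "norm (truncate n f \<nu> * truncate n g \<nu>) \<le> \<bar>f \<nu>\<bar> * \<bar>g \<nu>\<bar>"
        unfolding norm_mult using truncate_abs_le(2) by (intro mult_mono) auto
      also have "\<dots> \<le> (f \<nu>)\<^sup>2 + (g \<nu>)\<^sup>2"
      proof -
        have "2 * (\<bar>f \<nu>\<bar> * \<bar>g \<nu>\<bar>) \<le> (f \<nu>)\<^sup>2 + (g \<nu>)\<^sup>2"
          using sum_squares_bound[of "\<bar>f \<nu>\<bar>" "\<bar>g \<nu>\<bar>"] by simp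
        moreover have "0 \<le> \<bar>f \<nu>\<bar> * \<bar>g \<nu>\<bar>" by simp
        ultimately show ?thesis by linarith
      qed
      finally show "norm (truncate n f \<nu> * truncate n g \<nu>) \<le> (f \<nu>)\<^sup>2 + (g \<nu>)\<^sup>2" .
    qed
  qed measurable
  show "\<exists>N. \<forall>n\<ge>N. (\<integral>\<nu>. truncate n f \<nu> \<partial>law) * (\<integral>\<nu>. truncate n g \<nu> \<partial>law) \<le>
      (\<integral>\<nu>. truncate n f \<nu> * truncate n g \<nu> \<partial>law)"
    using m f(2) g(2) by (intro exI[of _ 0] allI impI association_truncate[OF sf B]) (simp_all cong: measurable_cong_sets)
qed

end

theorem theorem1p4:
  fixes M :: "'w measure" and Y lam :: "'a measure"
    and \<eta> :: "'w \<Rightarrow> 'a measure" and f g :: "'a measure \<Rightarrow> real" and B :: "'a set"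
  assumes "prob_space M"
    and "sets lam = sets Y"
    and "sigma_finite_measure lam"
    and "poisson_process M Y lam \<eta>"
    and "B \<in> sets Y"
    and "f \<in> L2_space (distr M (counting_measure_space Y) \<eta>)"
    and "g \<in> L2_space (distr M (counting_measure_space Y) \<eta>)"
    and "increasing_on Y B f" and "decreasing_on Y (space Y - B) f"
    and "increasing_on Y B g" and "decreasing_on Y (space Y - B) g"
  shows "prob_space.expectation M (\<lambda>\<omega>. f (\<eta> \<omega>) * g (\<eta> \<omega>)) \<ge>
         prob_space.expectation M (\<lambda>\<omega>. f (\<eta> \<omega>)) * prob_space.expectation M (\<lambda>\<omega>. g (\<eta> \<omega>))"
proof -
  interpret poisson_law M Y lam \<eta>
    unfolding poisson_law_def poisson_law_axioms_def using assms(1,2,4) by blast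
  have meas: "f \<in> borel_measurable (counting_measure_space Y)" "g \<in> borel_measurable (counting_measure_space Y)"
    using assms(6,7) by (auto simp: L2_space_def)
  have "(\<integral>\<nu>. f \<nu> \<partial>law) * (\<integral>\<nu>. g \<nu> \<partial>law) \<le> (\<integral>\<nu>. f \<nu> * g \<nu> \<partial>law)"
    using assms(6-11) by (intro association[OF assms(3,5)]) (simp_all add: law_def mixed_monotone_def)
  then show ?thesis
    using meas by (simp add: law_def integral_distr[OF eta_measurable])
qed

end
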